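(* Let $i=\sqrt{-1}$ and let $\frac{r}{s}>1$ be an irreducible fraction. Then $J_{\frac rs}(i)=0$ if $r\equiv2\pmod4$; $J_{\frac rs}(i)\in\{\pm(1+i),\pm(1-i)\}$ if $r\equiv0\pmod4$; and $J_{\frac rs}(i)\in\{\pm1,\pm i\}$ if $r\equiv1,3\pmod4$.
   Context: For a rational $\alpha>0$, $L(\alpha)$ denotes the rational (two-bridge) link associated with $\alpha$ via its continued fraction expansion, and $V_\alpha(t)\in\mathbb Z[t^{\pm1/2}]$ its Jones polynomial. The normalized Jones polynomial is $J_\alpha(q)=\pm t^{-h}V_\alpha(t)|_{t=-q^{-1}}$, where $\pm t^h$ is the leading term of $V_\alpha(t)$. It is known that for $\alpha>1$, $J_\alpha(q)=q\mathcal{R}_\alpha(q)+(1-q)\mathcal{S}_\alpha(q)$, where: $[c]_q=\frac{1-q^c}{1-q}$; writing $\alpha=c_1-\cfrac{1}{c_2-\cfrac{1}{\ddots-\cfrac{1}{c_l}}}$ with integers $c_j\ge2$ (unique) and $M^-_q(c)=\begin{pmatrix}[c]_q & -q^{c-1}\\ 1 & 0\end{pmatrix}$, one has $\begin{pmatrix}\mathcal{R}_\alpha(q)\\ \mathcal{S}_\alpha(q)\end{pmatrix}=M^-_q(c_1)\cdots M^-_q(c_l)\begin{pmatrix}1\\0\end{pmatrix}$. An irreducible fraction $\frac rs$ means $\gcd(r,s)=1$, $s>0$. *)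

theory Defs
  imports Complex_Main "HOL-Library.Poly_Mapping" "HOL-Number_Theory.Cong"
begin

section \<open>Link diagrams\<close>

text \<open>
  A planar diagram code is a list of nodes whose arguments are labels of edges; in the code of a
  link diagram every label occurs exactly twice. \<open>Cross a b c d\<close> is a crossing whose four incident
  edges are, in counterclockwise order, \<open>a, b, c, d\<close>, where \<open>a, c\<close> belong to the under-strand and
  \<open>b, d\<close> to the over-strand. \<open>Join a b\<close> says that the edges \<open>a\<close> and \<open>b\<close> are glued end to end.
\<close>

datatype node = Cross nat nat nat nat | Join nat nat

type_synonym diagram = "node list"

primrec node_labels :: "node \<Rightarrow> nat set" where
  "node_labels (Cross a b c d) = {a, b, c, d}"
| "node_labels (Join a b) = {a, b}"

definition labels :: "diagram \<Rightarrow> nat set" where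
  "labels D = (\<Union>x\<in>set D. node_labels x)"

section \<open>Kauffman bracket and Jones polynomial\<close>

text \<open>
  Laurent polynomials with integer coefficients are the group ring of the integers,
  \<^typ>\<open>int \<Rightarrow>\<^sub>0 int\<close>.
\<close>

type_synonym laurent = "int \<Rightarrow>\<^sub>0 int"

text \<open>
  The Kauffman states of a diagram. A state is recorded as the number of \<open>A\<close>-smoothings minus the
  number of \<open>B\<close>-smoothings, together with the pairs of edges that it connects. The two regions
  swept out when the over-strand \<open>b d\<close> is turned counterclockwise are those between \<open>b, c\<close> and
  between \<open>d, a\<close>; the \<open>A\<close>-smoothing merges them, so it connects \<open>a\<close> with \<open>b\<close> and \<open>c\<close> with \<open>d\<close>.
\<close>

fun states :: "diagram \<Rightarrow> (int \<times> (nat \<times> nat) set) list" where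
  "states [] = [(0, {})]"
| "states (Cross a b c d # D) =
     map (\<lambda>(k, G). (k + 1, {(a, b), (c, d)} \<union> G)) (states D) @
     map (\<lambda>(k, G). (k - 1, {(a, d), (b, c)} \<union> G)) (states D)"
| "states (Join a b # D) = map (\<lambda>(k, G). (k, {(a, b)} \<union> G)) (states D)"

definition loops :: "nat set \<Rightarrow> (nat \<times> nat) set \<Rightarrow> nat" where
  "loops L G = card ((\<lambda>v. (G \<union> G\<inverse>)\<^sup>* `` {v}) ` L)"

definition loop_value :: laurent where
  "loop_value = - Poly_Mapping.single 2 1 - Poly_Mapping.single (-2) 1"

definition bracket :: "diagram \<Rightarrow> laurent" where
  "bracket D =
     (\<Sum>(k, G)\<leftarrow>states D. Poly_Mapping.single k 1 * loop_value ^ (loops (labels D) G - 1))"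

text \<open>
  An orientation of a diagram gives a pair of directions \<open>(u, v)\<close> for each node. At \<open>Cross a b c d\<close>
  the under-strand runs from \<open>a\<close> to \<open>c\<close> if \<open>u\<close> and from \<open>c\<close> to \<open>a\<close> otherwise, and the over-strand runs
  from \<open>d\<close> to \<open>b\<close> if \<open>v\<close> and from \<open>b\<close> to \<open>d\<close> otherwise; so the crossing is positive iff \<open>u = v\<close>.
  At \<open>Join a b\<close> the strand runs from \<open>a\<close> to \<open>b\<close> if \<open>u\<close> and from \<open>b\<close> to \<open>a\<close> otherwise, and \<open>v\<close> is
  ignored. As each label occurs twice, the directions fit together iff no edge enters two nodes
  and no edge leaves two nodes.
\<close>

type_synonym direction = "bool \<times> bool"

fun node_in :: "node \<Rightarrow> direction \<Rightarrow> nat list" where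
  "node_in (Cross a b c d) (u, v) = [if u then a else c, if v then d else b]"
| "node_in (Join a b) (u, v) = [if u then a else b]"

fun node_out :: "node \<Rightarrow> direction \<Rightarrow> nat list" where
  "node_out (Cross a b c d) (u, v) = [if u then c else a, if v then b else d]"
| "node_out (Join a b) (u, v) = [if u then b else a]"

fun node_sign :: "node \<Rightarrow> direction \<Rightarrow> int" where
  "node_sign (Cross a b c d) (u, v) = (if u = v then 1 else -1)"
| "node_sign (Join a b) (u, v) = 0"

definition is_orientation :: "diagram \<Rightarrow> direction list \<Rightarrow> bool" where
  "is_orientation D ds \<longleftrightarrow> length ds = length D \<and>
     distinct (concat (map2 node_in D ds)) \<and> distinct (concat (map2 node_out D ds))"

definition writhe :: "diagram \<Rightarrow> direction list \<Rightarrow> int" where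
  "writhe D ds = sum_list (map2 node_sign D ds)"

text \<open>
  The Jones polynomial is \<open>(- A\<^sup>3)\<^sup>-\<^sup>w\<langle>D\<rangle>\<close>, with \<open>w\<close> the writhe, after substituting \<open>t = A\<^sup>-\<^sup>4\<close>. It is
  stored as a Laurent polynomial in \<open>t\<^sup>1\<^sup>/\<^sup>2 = A\<^sup>-\<^sup>2\<close>: the coefficient at index \<open>n\<close> is that of \<open>t\<^sup>n\<^sup>/\<^sup>2\<close>.
\<close>

definition jones :: "diagram \<Rightarrow> direction list \<Rightarrow> laurent" where
  "jones D ds = Poly_Mapping.map_key (\<lambda>n. - 2 * n)
     (Poly_Mapping.single (- 3 * writhe D ds) ((-1) ^ nat \<bar>writhe D ds\<bar>) * bracket D)"

text \<open>
  The function \<open>q \<mapsto> \<plusminus> t\<^sup>-\<^sup>h V(t)\<close> at \<open>t = - q\<^sup>-\<^sup>1\<close>, where \<open>\<plusminus> t\<^sup>h\<close> is the leading term of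
  the Jones polynomial \<open>V\<close> and \<open>h = m / 2\<close>. All exponents of \<open>t\<close> in \<open>V\<close> are congruent modulo 1.
\<close>

definition normalized_jones :: "diagram \<Rightarrow> direction list \<Rightarrow> complex \<Rightarrow> complex" where
  "normalized_jones D ds q =
     (let V = jones D ds; m = Max (Poly_Mapping.keys V) in
        of_int (sgn (Poly_Mapping.lookup V m)) *
        (\<Sum>n\<in>Poly_Mapping.keys V.
           of_int (Poly_Mapping.lookup V n) * (- inverse q) powi ((n - m) div 2)))"

section \<open>Rational links\<close>

fun cfrac :: "nat \<Rightarrow> nat \<Rightarrow> nat list" where
  "cfrac r s = (if s = 0 then [] else r div s # cfrac s (r mod s))"

declare cfrac.simps [simp del]

text \<open>The continued fraction \<open>a\<^sub>1 + 1/(a\<^sub>2 + 1/(\<dots> + 1/a\<^sub>n))\<close>, using \<open>inverse 0 = 0\<close>.\<close>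

lemma cfrac_value:
  "s > 0 \<Longrightarrow> foldr (\<lambda>a x. of_nat a + inverse x) (cfrac r s) 0 = (of_nat r / of_nat s :: rat)"
proof (induction r s rule: cfrac.induct)
  case (1 r s)
  have eq: "of_nat r = (of_nat (r div s) * of_nat s + of_nat (r mod s) :: rat)"
    by (metis div_mult_mod_eq of_nat_add of_nat_mult)
  show ?case
  proof (cases "r mod s = 0")
    case True
    then show ?thesis
      using 1(2) eq by (simp add: cfrac.simps[of r s] cfrac.simps[of s 0])
  next
    case False
    then have "foldr (\<lambda>a x. of_nat a + inverse x) (cfrac s (r mod s)) 0 =
        (of_nat s / of_nat (r mod s) :: rat)"
      using 1 by simp
    then show ?thesis
      using 1(2) eq by (simp add: cfrac.simps[of r s] add_divide_distrib)
  qed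
qed

text \<open>A tangle with its four end edges at the corners NW, NE, SW, SE.\<close>

record tangle =
  nodes :: diagram
  nw :: nat
  ne :: nat
  sw :: nat
  se :: nat

definition zero_tangle :: tangle where
  "zero_tangle = \<lparr>nodes = [], nw = 0, ne = 0, sw = 1, se = 1\<rparr>"

definition infinity_tangle :: tangle where
  "infinity_tangle = \<lparr>nodes = [], nw = 0, ne = 1, sw = 0, se = 1\<rparr>"

text \<open>
  Every twist adds a crossing whose over-strand has positive slope: on the right of the tangle
  (turning the fraction \<open>F\<close> into \<open>F + 1\<close>), or below it (turning \<open>1/F\<close> into \<open>1/F + 1\<close>). A tangle with
  \<open>k\<close> crossings uses the edges \<open>0, \<dots>, 2 k + 1\<close>.
\<close>

definition horizontal_twist :: "tangle \<Rightarrow> tangle" where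
  "horizontal_twist T =
     (let x = 2 * length (nodes T) + 2; y = x + 1 in
        T\<lparr>nodes := Cross y x (ne T) (se T) # nodes T, ne := x, se := y\<rparr>)"

definition vertical_twist :: "tangle \<Rightarrow> tangle" where
  "vertical_twist T =
     (let x = 2 * length (nodes T) + 2; y = x + 1 in
        T\<lparr>nodes := Cross y (se T) (sw T) x # nodes T, sw := x, se := y\<rparr>)"

text \<open>
  The rational tangle of fraction \<open>[a\<^sub>1, \<dots>, a\<^sub>n]\<close> (first argument true) or of its reciprocal: \<open>a\<^sub>n\<close>
  twists, followed by \<open>a\<^sub>n\<^sub>-\<^sub>1\<close> twists of the other kind, and so on.
\<close>

fun rational_tangle :: "bool \<Rightarrow> nat list \<Rightarrow> tangle" where
  "rational_tangle hor [] = (if hor then infinity_tangle else zero_tangle)"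
| "rational_tangle hor (a # as) =
     ((if hor then horizontal_twist else vertical_twist) ^^ a) (rational_tangle (\<not> hor) as)"

definition numerator_closure :: "tangle \<Rightarrow> diagram" where
  "numerator_closure T = Join (nw T) (ne T) # Join (sw T) (se T) # nodes T"

text \<open>
  The chirality is such that \<open>rational_link 3\<close> is the left-handed trefoil, as required by
  \<open>J\<^sub>\<alpha>(q) = q \<R>\<^sub>\<alpha>(q) + (1 - q) \<S>\<^sub>\<alpha>(q)\<close>, which is \<open>1 + q\<^sup>2 + q\<^sup>3\<close> for \<open>\<alpha> = 3\<close>.
\<close>

definition rational_link :: "rat \<Rightarrow> diagram" where
  "rational_link \<alpha> =
     (case quotient_of \<alpha> of (r, s) \<Rightarrow>
        numerator_closure (rational_tangle True (cfrac (nat r) (nat s))))"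


section \<open>Rational links are orientable\<close>

text \<open>
  \<open>p\<^sub>1, \<dots>, p\<^sub>4\<close> say whether the strands at NW, NE, SW, SE are directed out of the tangle.
\<close>

definition flow :: "tangle \<Rightarrow> bool \<Rightarrow> bool \<Rightarrow> bool \<Rightarrow> bool \<Rightarrow> direction list \<Rightarrow> bool" where
  "flow T p1 p2 p3 p4 ds \<longleftrightarrow> length ds = length (nodes T) \<and>
     distinct (concat (map2 node_in (nodes T) ds) @
       (if p1 then [nw T] else []) @ (if p2 then [ne T] else []) @
       (if p3 then [sw T] else []) @ (if p4 then [se T] else [])) \<and>
     distinct (concat (map2 node_out (nodes T) ds) @
       (if p1 then [] else [nw T]) @ (if p2 then [] else [ne T]) @
       (if p3 then [] else [sw T]) @ (if p4 then [] else [se T]))"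

definition bounded_labels :: "tangle \<Rightarrow> bool" where
  "bounded_labels T \<longleftrightarrow> {nw T, ne T, sw T, se T} \<union> labels (nodes T) \<subseteq> {..<2 * length (nodes T) + 2}"

lemma node_in_subset: "set (node_in x d) \<subseteq> node_labels x"
  by (cases x; cases d) auto

lemma node_out_subset: "set (node_out x d) \<subseteq> node_labels x"
  by (cases x; cases d) auto

lemma in_subset: "set (concat (map2 node_in D ds)) \<subseteq> labels D"
  using node_in_subset by (fastforce simp: labels_def dest: set_zip_leftD)

lemma out_subset: "set (concat (map2 node_out D ds)) \<subseteq> labels D"
  using node_out_subset by (fastforce simp: labels_def dest: set_zip_leftD)

lemma bounded_labels_twist:
  assumes "bounded_labels T"
  shows "bounded_labels (horizontal_twist T)" and "bounded_labels (vertical_twist T)"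
  using assms
  by (fastforce simp: bounded_labels_def horizontal_twist_def vertical_twist_def Let_def labels_def)+

lemma flow_cons:
  fixes D ds x
  defines "I \<equiv> concat (map2 node_in D ds)" and "U \<equiv> concat (map2 node_out D ds)"
  assumes "labels D \<subseteq> {..<x}"
  shows "x \<notin> set I" "Suc x \<notin> set I" "x \<notin> set U" "Suc x \<notin> set U"
  using assms in_subset[of D ds] out_subset[of D ds] by force+

lemma flow_horizontal:
  assumes "bounded_labels T" and "flow T p1 p2 p3 p4 ds"
  shows "flow (horizontal_twist T) p1 p4 p3 p2 ((\<not> p2, p4) # ds)"
proof -
  define x where "x = 2 * length (nodes T) + 2"
  have lt: "nw T < x" "ne T < x" "sw T < x" "se T < x" "labels (nodes T) \<subseteq> {..<x}"
    using assms(1) by (auto simp: bounded_labels_def x_def)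
  define I where "I = concat (map2 node_in (nodes T) ds)"
  define U where "U = concat (map2 node_out (nodes T) ds)"
  have fresh: "x \<notin> set I" "Suc x \<notin> set I" "x \<notin> set U" "Suc x \<notin> set U"
    using flow_cons[OF lt(5), of ds] by (simp_all add: I_def U_def)
  show ?thesis
    using assms(2) lt(1-4) fresh
    unfolding flow_def horizontal_twist_def Let_def x_def[symmetric]
    by (cases p1; cases p2; cases p3; cases p4)
      (auto simp: I_def[symmetric] U_def[symmetric] simp del: set_concat)
qed

lemma flow_vertical:
  assumes "bounded_labels T" and "flow T p1 p2 p3 p4 ds"
  shows "flow (vertical_twist T) p1 p2 p4 p3 ((\<not> p3, \<not> p4) # ds)"
proof -
  define x where "x = 2 * length (nodes T) + 2"
  have lt: "nw T < x" "ne T < x" "sw T < x" "se T < x" "labels (nodes T) \<subseteq> {..<x}"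
    using assms(1) by (auto simp: bounded_labels_def x_def)
  define I where "I = concat (map2 node_in (nodes T) ds)"
  define U where "U = concat (map2 node_out (nodes T) ds)"
  have fresh: "x \<notin> set I" "Suc x \<notin> set I" "x \<notin> set U" "Suc x \<notin> set U"
    using flow_cons[OF lt(5), of ds] by (simp_all add: I_def U_def)
  show ?thesis
    using assms(2) lt(1-4) fresh
    unfolding flow_def vertical_twist_def Let_def x_def[symmetric]
    by (cases p1; cases p2; cases p3; cases p4)
      (auto simp: I_def[symmetric] U_def[symmetric] simp del: set_concat)
qed

text \<open>The two strands of a tangle connect its corners in one of three ways.\<close>

definition orientable :: "tangle \<Rightarrow> bool" where
  "orientable T \<longleftrightarrow> bounded_labels T \<and>
     ((\<forall>p q. \<exists>ds. flow T p (\<not> p) q (\<not> q) ds) \<or>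
      (\<forall>p q. \<exists>ds. flow T p q (\<not> p) (\<not> q) ds) \<or>
      (\<forall>p q. \<exists>ds. flow T p q (\<not> q) (\<not> p) ds))"

lemma orientable_horizontal:
  assumes "orientable T"
  shows "orientable (horizontal_twist T)"
proof -
  have b: "bounded_labels T"
    using assms by (simp add: orientable_def)
  have "\<exists>ds. flow (horizontal_twist T) p1 p4 p3 p2 ds" if "\<exists>ds. flow T p1 p2 p3 p4 ds" for p1 p2 p3 p4
    using that flow_horizontal[OF b] by blast
  then show ?thesis
    using assms bounded_labels_twist(1)[OF b] unfolding orientable_def all_bool_eq
    by (simp only: simp_thms) blast
qed

lemma orientable_vertical:
  assumes "orientable T"
  shows "orientable (vertical_twist T)"
proof -
  have b: "bounded_labels T"
    using assms by (simp add: orientable_def)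
  have "\<exists>ds. flow (vertical_twist T) p1 p2 p4 p3 ds" if "\<exists>ds. flow T p1 p2 p3 p4 ds" for p1 p2 p3 p4
    using that flow_vertical[OF b] by blast
  then show ?thesis
    using assms bounded_labels_twist(2)[OF b] unfolding orientable_def all_bool_eq
    by (simp only: simp_thms) blast
qed

lemma orientable_rational_tangle: "orientable (rational_tangle hor as)"
proof (induction as arbitrary: hor)
  case Nil
  show ?case
    by (auto simp: orientable_def bounded_labels_def labels_def flow_def
        infinity_tangle_def zero_tangle_def)
next
  case (Cons a as)
  have "orientable ((f ^^ a) T)" if "\<And>T. orientable T \<Longrightarrow> orientable (f T)" "orientable T" for f T
    using that by (induction a) auto
  then show ?case
    using Cons orientable_horizontal orientable_vertical by simp
qed

lemma rational_link_orientable: "\<exists>ds. is_orientation (rational_link \<alpha>) ds"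
proof -
  obtain r s where rs: "quotient_of \<alpha> = (r, s)"
    by fastforce
  define T where "T = rational_tangle True (cfrac (nat r) (nat s))"
  have "orientable T"
    by (simp add: T_def orientable_rational_tangle)
  then have "\<exists>p q ds. flow T p (\<not> p) q (\<not> q) ds"
    unfolding orientable_def all_bool_eq ex_bool_eq by (simp only: simp_thms) blast
  then obtain p q ds where fl: "flow T p (\<not> p) q (\<not> q) ds"
    by blast
  have "is_orientation (numerator_closure T) ((p, True) # (q, True) # ds)"
    using fl unfolding flow_def is_orientation_def numerator_closure_def
    by (cases p; cases q) auto
  then show ?thesis
    using rs by (auto simp: rational_link_def T_def)
qed

end

theory Submission
  imports Defs
begin

text \<open>Because only absolute values are compared, the leading term of the Jones polynomial is
  never computed: its sign and exponent contribute a factor of modulus 1. The obstacle lies in the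
  passage from bracket to normalization. \<open>jones\<close> reads off only the even exponents of
  \<open>A\<close>, and \<open>normalized_jones\<close> halves exponent differences with
  \<open>div\<close>. Neither loses anything provided that all exponents of the bracket agree modulo
  4 and have the parity of the writhe, so a grade modulo 4 is carried through the construction of
  the tangle. The modulus 4 for fractions has another source. On the pair of coefficients a
  horizontal twist has the eigenvalues \<open>inverse A\<close> and \<open>- (A ^ 3)\<close>, a
  vertical one \<open>A\<close> and \<open>- (inverse A ^ 3)\<close>. The eigenvalues of each differ
  by the factor \<open>- (A ^ 4)\<close> or its inverse, which for \<open>A ^ 4 = - \<i>\<close> is
  a primitive fourth root of unity, so the fourth power of either twist is a scalar of modulus
  1.\<close>

text \<open>
  At \<open>q = \<i>\<close> we have \<open>t = \<i>\<close>, so \<open>A\<close> is a primitive 16th root of unity, and the normalized Jones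
  polynomial is a Gaussian integer whose absolute value is that of the Kauffman bracket at \<open>A\<close>.
  Hence it suffices to show that this absolute value squared is 0, 2 or 1. The bracket of the
  rational tangle \<open>p / q\<close> is a combination of the brackets of the tangles 0 and \<open>\<infinity>\<close>, and at \<open>A\<close> the
  two coefficients depend, up to a common phase, only on \<open>p / q\<close> as a point of the projective line
  over the integers modulo 4.
\<close>

section \<open>Connected components\<close>

definition conn :: "(nat \<times> nat) set \<Rightarrow> nat \<Rightarrow> nat \<Rightarrow> bool" where
  "conn G u v \<longleftrightarrow> (u, v) \<in> (G \<union> G\<inverse>)\<^sup>*"

lemma conn_refl [simp]: "conn G u u"
  by (simp add: conn_def)

lemma conn_sym: "conn G u v \<Longrightarrow> conn G v u"
  unfolding conn_def by (meson sym_Un_converse sym_rtrancl symD)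

lemma conn_commute: "conn G u v \<longleftrightarrow> conn G v u"
  using conn_sym by blast

lemma conn_trans: "conn G u v \<Longrightarrow> conn G v w \<Longrightarrow> conn G u w"
  unfolding conn_def by (rule rtrancl_trans)

text \<open>A path in the enlarged graph can be shortened until it crosses the new edge at most
  once, in one of the two directions.\<close>

lemma conn_insert:
  "conn (insert (a, b) G) u v \<longleftrightarrow>
     conn G u v \<or> (conn G u a \<and> conn G b v) \<or> (conn G u b \<and> conn G a v)"
proof -
  have eq: "insert (a, b) G \<union> (insert (a, b) G)\<inverse> = insert (a, b) (insert (b, a) (G \<union> G\<inverse>))"
    by auto
  show ?thesis
    \<comment> \<open>\<open>rtrancl_insert\<close> applies once for each direction of the new edge;
      the paths crossing it both ways collapse by transitivity.\<close>
    unfolding conn_def eq rtrancl_insert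
    by (simp flip: conn_def) (meson conn_refl conn_sym conn_trans)
qed

lemma conn_outside:
  assumes "G \<subseteq> L \<times> L" and "x \<notin> L"
  shows "conn G x v \<longleftrightarrow> v = x" and "conn G v x \<longleftrightarrow> v = x"
proof -
  have "v = x" if "(x, v) \<in> (G \<union> G\<inverse>)\<^sup>*" for v
    using that by (induction rule: rtrancl_induct) (use assms in auto)
  then show *: "conn G x v \<longleftrightarrow> v = x"
    by (auto simp: conn_def)
  then show "conn G v x \<longleftrightarrow> v = x"
    using conn_commute by blast
qed

lemma loops_conn: "loops L G = card ((\<lambda>v. {w. conn G v w}) ` L)"
  by (simp add: loops_def conn_def Image_def)

lemma conn_class_eq_iff: "{w. conn G u w} = {w. conn G v w} \<longleftrightarrow> conn G u v"
proof
  assume "{w. conn G u w} = {w. conn G v w}"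
  then have "u \<in> {w. conn G v w}"
    by auto
  then show "conn G u v"
    using conn_sym by blast
next
  assume "conn G u v"
  then show "{w. conn G u w} = {w. conn G v w}"
    by (metis conn_sym conn_trans)
qed

lemma loops_insert_connected:
  assumes "conn G a b"
  shows "loops L (insert (a, b) G) = loops L G"
proof -
  have "conn (insert (a, b) G) u v \<longleftrightarrow> conn G u v" for u v
    unfolding conn_insert using assms conn_trans conn_sym by metis
  then show ?thesis
    by (simp add: loops_conn)
qed

text \<open>The classes of \<open>a\<close> and \<open>b\<close> fuse into one. \<open>M\<close>
  collects the vertices of \<open>L\<close> in all other classes, which stay as they are.\<close>

lemma loops_insert_unconnected:
  assumes "\<not> conn G a b" and "a \<in> L" "b \<in> L" and "finite L"
  shows "Suc (loops L (insert (a, b) G)) = loops L G"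
proof -
  define C where "C = (\<lambda>v. {w. conn G v w})"
  define C' where "C' = (\<lambda>v. {w. conn (insert (a, b) G) v w})"
  define M where "M = {v \<in> L. \<not> conn G v a \<and> \<not> conn G v b}"
  have Ceq: "C u = C v \<longleftrightarrow> conn G u v" for u v
    by (simp add: C_def conn_class_eq_iff)
  have C'eq: "C' u = C' v \<longleftrightarrow> conn (insert (a, b) G) u v" for u v
    by (simp add: C'_def conn_class_eq_iff)
  have 1: "C ` L = insert (C a) (insert (C b) (C ` M))"
  proof -
    have "C v = C a \<or> C v = C b" if "v \<in> L" "v \<notin> M" for v
      using that unfolding Ceq M_def by auto
    then show ?thesis
      using assms by (auto simp only: M_def)
  qed
  have 2: "C' ` L = insert (C' a) (C' ` M)"
  proof -
    have "C' v = C' a" if "v \<in> L" "v \<notin> M" for v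
      using that unfolding C'eq conn_insert M_def by auto
    then show ?thesis
      using assms by (auto simp only: M_def)
  qed
  have 3: "C' v = C v" if "v \<in> M" for v
    using that by (auto simp: C'_def C_def conn_insert M_def)
  have "finite M"
    using assms by (simp add: M_def)
  moreover have "C a \<noteq> C b" "C a \<notin> C ` M" "C b \<notin> C ` M"
    unfolding image_iff Ceq using assms conn_sym by (auto simp: M_def)
  moreover have "C' a \<notin> C' ` M"
    unfolding image_iff C'eq conn_insert using conn_sym by (auto simp: M_def)
  moreover have "C' ` M = C ` M"
    using 3 by (rule image_cong[OF refl])
  ultimately show ?thesis
    unfolding loops_conn C_def[symmetric] C'_def[symmetric] 1 2 by simp
qed

lemma loops_fresh:
  assumes "G \<subseteq> L \<times> L" and "x \<notin> L" and "finite L"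
  shows "loops (insert x L) G = Suc (loops L G)"
proof -
  have "{w. conn G x w} \<notin> (\<lambda>v. {w. conn G v w}) ` L"
    unfolding image_iff conn_class_eq_iff using assms(2) conn_outside[OF assms(1,2)] by auto
  then show ?thesis
    using assms by (simp add: loops_conn)
qed

section \<open>Laurent polynomials\<close>

definition laurent_eval :: "complex \<Rightarrow> laurent \<Rightarrow> complex" where
  "laurent_eval z p = (\<Sum>k\<in>Poly_Mapping.keys p. of_int (Poly_Mapping.lookup p k) * z powi k)"

lemma laurent_eval_0 [simp]: "laurent_eval z 0 = 0"
  by (simp add: laurent_eval_def)

lemma laurent_eval_add: "laurent_eval z (p + q) = laurent_eval z p + laurent_eval z q"
  unfolding laurent_eval_def
  by (rule setsum_keys_plus_distrib[where f = "\<lambda>k c. of_int c * z powi k"]) (auto simp: algebra_simps)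

lemma laurent_eval_uminus: "laurent_eval z (- p) = - laurent_eval z p"
  using laurent_eval_add[of z p "- p"] by (simp add: eq_neg_iff_add_eq_0 add.commute)

lemma laurent_eval_diff: "laurent_eval z (p - q) = laurent_eval z p - laurent_eval z q"
  using laurent_eval_add[of z p "- q"] by (simp add: laurent_eval_uminus)

lemma laurent_eval_single [simp]:
  "laurent_eval z (Poly_Mapping.single k c) = of_int c * z powi k"
  by (simp add: laurent_eval_def)

text \<open>Polynomial mappings with integer coefficients form a free abelian group, so additivity
  in both factors reduces the claim to monomials with coefficient 1.\<close>

lemma laurent_eval_mult:
  assumes "z \<noteq> 0"
  shows "laurent_eval z (p * q) = laurent_eval z p * laurent_eval z q"
proof (induction p rule: frag_induction[OF subset_UNIV])
  case (2 k)
  show ?case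
    by (induction q rule: frag_induction[OF subset_UNIV])
      (use assms in \<open>simp_all add: mult_single power_int_add laurent_eval_diff right_diff_distrib\<close>)
qed (simp_all add: laurent_eval_diff left_diff_distrib)

lemma laurent_eval_power:
  assumes "z \<noteq> 0"
  shows "laurent_eval z (p ^ n) = laurent_eval z p ^ n"
proof (induction n)
  case 0
  show ?case
    unfolding power_0 single_one[symmetric] by (simp del: single_one)
qed (simp add: laurent_eval_mult[OF assms])

lemma laurent_eval_sum_list:
  "laurent_eval z (\<Sum>x\<leftarrow>xs. f x) = (\<Sum>x\<leftarrow>xs. laurent_eval z (f x))"
  by (induction xs) (simp_all add: laurent_eval_add)

section \<open>Exponents modulo 4\<close>

definition homogeneous_mod4 :: "int \<Rightarrow> laurent \<Rightarrow> bool" where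
  "homogeneous_mod4 e p \<longleftrightarrow> (\<forall>k\<in>Poly_Mapping.keys p. [k = e] (mod 4))"

lemma homogeneous_mod4_single: "[k = e] (mod 4) \<Longrightarrow> homogeneous_mod4 e (Poly_Mapping.single k c)"
  by (simp add: homogeneous_mod4_def)

lemma homogeneous_mod4_add:
  "homogeneous_mod4 e p \<Longrightarrow> homogeneous_mod4 e q \<Longrightarrow> homogeneous_mod4 e (p + q)"
  unfolding homogeneous_mod4_def using Poly_Mapping.keys_add[of p q] by blast

lemma homogeneous_mod4_mult:
  "homogeneous_mod4 e p \<Longrightarrow> homogeneous_mod4 f q \<Longrightarrow> homogeneous_mod4 (e + f) (p * q)"
  unfolding homogeneous_mod4_def using keys_mult[of p q] by (fastforce intro: cong_add)

lemma homogeneous_mod4_power: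
  "homogeneous_mod4 e p \<Longrightarrow> homogeneous_mod4 (int n * e) (p ^ n)"
proof (induction n)
  case 0
  show ?case
    by (simp add: homogeneous_mod4_def)
next
  case (Suc n)
  then show ?case
    using homogeneous_mod4_mult[of e p "int n * e" "p ^ n"] by (simp add: algebra_simps)
qed

lemma homogeneous_mod4_sum_list:
  "(\<And>x. x \<in> set xs \<Longrightarrow> homogeneous_mod4 e (f x)) \<Longrightarrow> homogeneous_mod4 e (\<Sum>x\<leftarrow>xs. f x)"
  by (induction xs) (auto intro: homogeneous_mod4_add simp: homogeneous_mod4_def[of _ 0])

text \<open>The exponents \<open>2\<close> and \<open>-2\<close> agree modulo 4, so each loop shifts
  the residue of the exponent by 2.\<close>

lemma homogeneous_mod4_loop_value: "homogeneous_mod4 2 loop_value"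
proof -
  have "loop_value = Poly_Mapping.single 2 (-1) + Poly_Mapping.single (-2) (-1)"
    by (simp add: loop_value_def single_uminus)
  moreover have "homogeneous_mod4 2 \<dots>"
    by (intro homogeneous_mod4_add homogeneous_mod4_single) (simp_all add: cong_def)
  ultimately show ?thesis
    by simp
qed

section \<open>Gaussian integers of norm 1 and 2\<close>

definition gaussian :: "complex \<Rightarrow> bool" where
  "gaussian z \<longleftrightarrow> Re z \<in> \<int> \<and> Im z \<in> \<int>"

lemma gaussian_of_int: "gaussian (of_int n)"
  by (simp add: gaussian_def)

lemma gaussian_mult: "gaussian x \<Longrightarrow> gaussian y \<Longrightarrow> gaussian (x * y)"
  by (simp add: gaussian_def)

lemma gaussian_sum: "(\<And>x. x \<in> S \<Longrightarrow> gaussian (f x)) \<Longrightarrow> gaussian (\<Sum>x\<in>S. f x)"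
  by (simp add: gaussian_def Ints_sum)

lemma gaussian_power: "gaussian x \<Longrightarrow> gaussian (x ^ n)"
  by (induction n) (simp_all add: gaussian_mult gaussian_of_int[of 1, simplified])

lemma gaussian_powi_ii: "gaussian (\<i> powi k)"
proof -
  have "gaussian \<i>" "gaussian (inverse \<i>)"
    by (simp_all add: gaussian_def)
  then show ?thesis
    by (simp add: power_int_def gaussian_power del: inverse_i)
qed

lemma gaussian_norm_eq_1:
  assumes "gaussian z" and "(cmod z)\<^sup>2 = 1"
  shows "z \<in> {1, -1, \<i>, -\<i>}"
proof -
  obtain x y :: int where xy: "Re z = of_int x" "Im z = of_int y"
    using assms(1) by (auto simp: gaussian_def elim!: Ints_cases)
  then have "of_int (x\<^sup>2 + y\<^sup>2) = (1 :: real)"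
    using assms(2) by (simp add: cmod_power2)
  then have eq: "x\<^sup>2 + y\<^sup>2 = 1"
    by linarith
  have "\<bar>x\<bar> \<le> 1" "\<bar>y\<bar> \<le> 1"
    using eq abs_le_square_iff[of x 1] abs_le_square_iff[of y 1] 
      zero_le_power2[of x] zero_le_power2[of y] unfolding power_one abs_1 by linarith+
  then have "x \<in> {-1, 0, 1}" "y \<in> {-1, 0, 1}"
    by auto
  then show ?thesis
    using eq xy by (auto simp: complex_eq_iff)
qed

lemma gaussian_norm_eq_2:
  assumes "gaussian z" and "(cmod z)\<^sup>2 = 2"
  shows "z \<in> {1 + \<i>, - (1 + \<i>), 1 - \<i>, - (1 - \<i>)}"
proof -
  obtain x y :: int where xy: "Re z = of_int x" "Im z = of_int y"
    using assms(1) by (auto simp: gaussian_def elim!: Ints_cases)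
  then have "of_int (x\<^sup>2 + y\<^sup>2) = (2 :: real)"
    using assms(2) by (simp add: cmod_power2)
  then have eq: "x\<^sup>2 + y\<^sup>2 = 2"
    by linarith
  have "\<bar>x\<bar> < 2" "\<bar>y\<bar> < 2"
    using eq abs_le_square_iff[of 2 x] abs_le_square_iff[of 2 y] 
      zero_le_power2[of x] zero_le_power2[of y] by (auto simp: not_le[symmetric])
  then have "x \<in> {-1, 0, 1}" "y \<in> {-1, 0, 1}"
    by auto
  then show ?thesis
    using eq xy by (auto simp: complex_eq_iff)
qed

text \<open>At \<open>q = \<i>\<close> the base \<open>- inverse q\<close> is \<open>\<i>\<close>
  itself, and \<open>div\<close> makes its exponents integers.\<close>

lemma gaussian_normalized_jones: "gaussian (normalized_jones D ds \<i>)"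
  unfolding normalized_jones_def Let_def
  by (auto intro!: gaussian_mult gaussian_of_int gaussian_sum gaussian_powi_ii)

section \<open>Modulus of the normalized Jones polynomial\<close>

lemma cmod_root:
  assumes "A ^ 8 = - 1"
  shows "cmod A = 1"
proof -
  have "(cmod A) ^ 8 = 1"
    using arg_cong[OF assms, of cmod] by (simp add: norm_power)
  then show ?thesis
    by (metis norm_ge_zero power_eq_1_iff zero_neq_numeral real_norm_def abs_of_nonneg)
qed

text \<open>The two sides differ by a sign, the writhe factor and the power of \<open>t\<close>
  split off with the leading term, all of modulus 1 at \<open>A\<close>. Homogeneity makes the
  halved exponents exact; the parity condition makes all exponents of \<open>A\<close> even after
  the writhe correction.\<close>

lemma cmod_normalized_jones:
  assumes A: "A ^ 4 = - \<i>"
    and hom: "homogeneous_mod4 e (bracket D)" and par: "even (e + writhe D ds)"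
  shows "cmod (normalized_jones D ds \<i>) = cmod (laurent_eval A (bracket D))"
proof -
  define w where "w = writhe D ds"
  define P where "P = Poly_Mapping.single (- 3 * w) ((-1) ^ nat \<bar>w\<bar>) * bracket D"
  define V where "V = jones D ds"
  define K where "K = Poly_Mapping.keys V"
  define m where "m = Max K"
  \<comment> \<open>The value of the square root of \<open>t\<close>; its square is
    \<open>\<i>\<close>, the value of \<open>t\<close> at \<open>q = \<i>\<close>.\<close>
  define z where "z = A powi (- 2)"
  have inj: "inj (\<lambda>n::int. - 2 * n)"
    by (simp add: inj_def)
  have VP: "V = Poly_Mapping.map_key (\<lambda>n. - 2 * n) P"
    by (simp add: V_def jones_def P_def w_def)
  have look: "Poly_Mapping.lookup V n = Poly_Mapping.lookup P (- 2 * n)" for n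
    unfolding VP by (simp add: map_key.rep_eq[OF inj])
  have A0: "A \<noteq> 0"
    using A by auto
  have "A ^ 8 = - 1"
    using arg_cong[OF A, of "\<lambda>x. x ^ 2"] by (simp flip: power_mult)
  then have nA: "cmod A = 1"
    by (rule cmod_root)
  have z2: "z powi 2 = \<i>"
  proof -
    have "z powi 2 = inverse (A ^ 4)"
      unfolding z_def power_int_mult[symmetric] by (simp add: power_int_minus)
    then show ?thesis
      using A by simp
  qed
  have z0: "z \<noteq> 0" and nz: "cmod z = 1"
    using A0 nA by (simp_all add: z_def norm_power_int)
  have homP: "homogeneous_mod4 (- 3 * w + e) P"
    unfolding P_def by (intro homogeneous_mod4_mult homogeneous_mod4_single hom) simp
  have P4: "4 dvd k - (- 3 * w + e)" if "k \<in> Poly_Mapping.keys P" for k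
    using homP that by (auto simp: homogeneous_mod4_def cong_iff_dvd_diff)
  have even_key: "even k" if "k \<in> Poly_Mapping.keys P" for k
    using P4[OF that] par unfolding w_def[symmetric] by presburger
  \<comment> \<open>\<open>map_key\<close> would silently drop odd exponents; by
    \<open>even_key\<close> there are none, so \<open>V\<close> keeps every term of
    \<open>P\<close>.\<close>
  have keysP: "Poly_Mapping.keys P = (\<lambda>n. - 2 * n) ` K"
  proof (intro equalityI subsetI)
    fix k assume k: "k \<in> Poly_Mapping.keys P"
    then obtain n where "k = - 2 * n"
      using even_key[OF k] by (metis dvdE minus_mult_minus mult_minus_left)
    then show "k \<in> (\<lambda>n. - 2 * n) ` K"
      using k by (auto simp: K_def in_keys_iff look)
  qed (auto simp: K_def in_keys_iff look)
  \<comment> \<open>Hence \<open>(n - m) div 2\<close> is an exact half, and powers of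
    \<open>\<i>\<close> become powers of \<open>z\<close>.\<close>
  have cong2: "even (n - n')" if "n \<in> K" "n' \<in> K" for n n'
  proof -
    have "4 dvd - 2 * n - (- 3 * w + e)" "4 dvd - 2 * n' - (- 3 * w + e)"
      using that by (auto intro!: P4 simp only: keysP)
    then show ?thesis
      by presburger
  qed
  have fin: "finite K"
    by (simp add: K_def)
  have evP: "laurent_eval A P = (\<Sum>n\<in>K. of_int (Poly_Mapping.lookup V n) * z powi n)"
    unfolding laurent_eval_def keysP
    by (subst sum.reindex)
      (auto simp: inj_on_def look z_def power_int_mult[symmetric] intro!: sum.cong)
  have "(\<Sum>n\<in>K. of_int (Poly_Mapping.lookup V n) * \<i> powi ((n - m) div 2)) =
      (\<Sum>n\<in>K. of_int (Poly_Mapping.lookup V n) * z powi n * z powi (- m))"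
  proof (rule sum.cong[OF refl])
    fix n assume n: "n \<in> K"
    have "m \<in> K"
      using n fin by (auto simp: m_def intro!: Max_in)
    then have "even (n - m)"
      using n cong2 by blast
    then have "\<i> powi ((n - m) div 2) = z powi (n - m)"
      unfolding z2[symmetric] power_int_mult[symmetric] by simp
    then show "of_int (Poly_Mapping.lookup V n) * \<i> powi ((n - m) div 2) =
        of_int (Poly_Mapping.lookup V n) * z powi n * z powi (- m)"
      using z0 by (simp add: power_int_diff power_int_minus divide_inverse)
  qed
  also have "\<dots> = laurent_eval A P * z powi (- m)"
    by (simp add: evP sum_distrib_right)
  finally have nj: "normalized_jones D ds \<i> =
      of_int (sgn (Poly_Mapping.lookup V m)) * (laurent_eval A P * z powi (- m))"
    by (simp add: normalized_jones_def V_def[symmetric] K_def[symmetric] m_def[symmetric] Let_def)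
  have "cmod (normalized_jones D ds \<i>) = cmod (laurent_eval A P)"
  \<comment> \<open>For empty \<open>K\<close> the value of \<open>m\<close> is unspecified, but the
    sum vanishes anyway.\<close>
  proof (cases "K = {}")
    case True
    then show ?thesis
      by (simp add: nj evP)
  next
    case False
    then have "m \<in> K"
      using fin by (simp add: m_def)
    then have "Poly_Mapping.lookup V m \<noteq> 0"
      by (simp add: K_def in_keys_iff)
    then show ?thesis
      by (simp add: nj norm_mult norm_power_int nz sgn_if)
  qed
  also have "\<dots> = cmod (laurent_eval A (bracket D))"
    using nA by (simp add: P_def laurent_eval_mult[OF A0] norm_mult norm_power_int norm_power)
  finally show ?thesis .
qed

section \<open>Kauffman states of tangles\<close>

text \<open>One smoothing of a twist: the new edges \<open>x\<close>, \<open>y\<close> prolong the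
  old ends \<open>p\<close>, \<open>q\<close> and inherit their connections.\<close>

lemma conn_extend_strands:
  assumes "G \<subseteq> L \<times> L" and "p \<in> L" "q \<in> L" and "x \<notin> L" "y \<notin> L" "x \<noteq> y"
  defines "G' \<equiv> insert (y, q) (insert (x, p) G)"
  shows "u \<in> L \<Longrightarrow> v \<in> L \<Longrightarrow> conn G' u v \<longleftrightarrow> conn G u v"
    and "u \<in> L \<Longrightarrow> conn G' u x \<longleftrightarrow> conn G u p"
    and "u \<in> L \<Longrightarrow> conn G' u y \<longleftrightarrow> conn G u q"
    and "conn G' x y \<longleftrightarrow> conn G p q"
  using assms conn_outside[OF assms(1,4)] conn_outside[OF assms(1,5)]
  by (auto simp: G'_def conn_insert)

text \<open>The other smoothing of a twist: the old ends \<open>p\<close>, \<open>q\<close> are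
  joined to each other, and \<open>x\<close>, \<open>y\<close> form a component of their
  own.\<close>

lemma conn_new_arc:
  assumes "G \<subseteq> L \<times> L" and "p \<in> L" "q \<in> L" and "x \<notin> L" "y \<notin> L" "x \<noteq> y"
  defines "G' \<equiv> insert (y, x) (insert (p, q) G)"
  shows "u \<in> L \<Longrightarrow> v \<in> L \<Longrightarrow> conn G' u v \<longleftrightarrow> conn (insert (p, q) G) u v"
    and "u \<in> L \<Longrightarrow> \<not> conn G' u x"
    and "u \<in> L \<Longrightarrow> \<not> conn G' u y"
    and "conn G' x y"
proof -
  have "insert (p, q) G \<subseteq> L \<times> L"
    using assms by auto
  from conn_outside[OF this assms(4)] conn_outside[OF this assms(5)]
  show "u \<in> L \<Longrightarrow> v \<in> L \<Longrightarrow> conn G' u v \<longleftrightarrow> conn (insert (p, q) G) u v"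
    and "u \<in> L \<Longrightarrow> \<not> conn G' u x"
    and "u \<in> L \<Longrightarrow> \<not> conn G' u y"
    and "conn G' x y"
    using assms(4-6) by (auto simp: G'_def conn_insert[of y x])
qed

lemma loops_two_fresh:
  assumes "G \<subseteq> L \<times> L" and "x \<notin> L" "y \<notin> L" "x \<noteq> y" and "finite L"
  shows "loops (insert y (insert x L)) G = loops L G + 2"
proof -
  have "G \<subseteq> insert x L \<times> insert x L"
    using assms by auto
  then show ?thesis
    using loops_fresh[of G "insert x L" y] loops_fresh[of G L x] assms by simp
qed

text \<open>The two fresh vertices add two classes, and the two arcs merge them into old
  ones.\<close>

lemma loops_extend_strands:
  assumes "G \<subseteq> L \<times> L" and "p \<in> L" "q \<in> L" and "x \<notin> L" "y \<notin> L" "x \<noteq> y" and "finite L"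
  shows "loops (insert y (insert x L)) (insert (y, q) (insert (x, p) G)) = loops L G"
proof -
  let ?L = "insert y (insert x L)"
  have 1: "\<not> conn G x p" and 2: "\<not> conn (insert (x, p) G) y q"
    using assms conn_outside[OF assms(1,4)] conn_outside[OF assms(1,5)]
    by (auto simp: conn_insert)
  have "Suc (Suc (loops ?L (insert (y, q) (insert (x, p) G)))) = loops ?L G"
    using loops_insert_unconnected[OF 1, of ?L] loops_insert_unconnected[OF 2, of ?L] assms by simp
  then show ?thesis
    using loops_two_fresh[of G L x y] assms by simp
qed

text \<open>The arc between \<open>x\<close> and \<open>y\<close> adds one component. The arc
  between \<open>p\<close> and \<open>q\<close> closes a loop if they were connected, and otherwise
  merges two components, which cancels the gain.\<close>

lemma loops_new_arc:
  assumes "G \<subseteq> L \<times> L" and "p \<in> L" "q \<in> L" and "x \<notin> L" "y \<notin> L" "x \<noteq> y" and "finite L"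
  shows "loops (insert y (insert x L)) (insert (y, x) (insert (p, q) G)) =
    (if conn G p q then Suc (loops L G) else loops L G)"
proof -
  let ?L = "insert y (insert x L)"
  have sub: "insert (p, q) G \<subseteq> L \<times> L"
    using assms by auto
  have "\<not> conn (insert (p, q) G) y x"
    using conn_outside[OF sub assms(5)] assms by simp
  then have "Suc (loops ?L (insert (y, x) (insert (p, q) G))) = loops ?L (insert (p, q) G)"
    by (rule loops_insert_unconnected) (use assms in auto)
  also have "\<dots> = loops L (insert (p, q) G) + 2"
    using loops_two_fresh[OF sub] assms by simp
  finally show ?thesis
    using loops_insert_connected[of G p q L] loops_insert_unconnected[of G p q L] assms by auto
qed

text \<open>The connection pattern of the tangle 0; \<open>joins_columns\<close> is that of the
  tangle \<infinity>. That no state joins corners diagonally is obtained by induction on twists, as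
  part of \<open>state_of_grade\<close>, instead of from planarity.\<close>

definition joins_rows :: "tangle \<Rightarrow> (nat \<times> nat) set \<Rightarrow> bool" where
  "joins_rows T G \<longleftrightarrow>
     conn G (nw T) (ne T) \<and> conn G (sw T) (se T) \<and> \<not> conn G (nw T) (sw T)"

definition joins_columns :: "tangle \<Rightarrow> (nat \<times> nat) set \<Rightarrow> bool" where
  "joins_columns T G \<longleftrightarrow>
     conn G (nw T) (sw T) \<and> conn G (ne T) (se T) \<and> \<not> conn G (nw T) (ne T)"

lemma not_joins_both: "joins_rows T G \<Longrightarrow> \<not> joins_columns T G"
  by (simp add: joins_rows_def joins_columns_def)

text \<open>Determined by the number of crossings and not by the nodes, since a tangle without
  crossings still has two edges.\<close>

definition edges :: "tangle \<Rightarrow> nat set" where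
  "edges T = {..<2 * length (nodes T) + 2}"

lemma finite_edges [simp]: "finite (edges T)"
  by (simp add: edges_def)

abbreviation tangle_loops :: "tangle \<Rightarrow> (nat \<times> nat) set \<Rightarrow> nat" where
  "tangle_loops T G \<equiv> loops (edges T) G"

text \<open>
  A smoothing change adds \<open>\<plusminus>2\<close> to the exponent and either changes the number of loops by one or
  changes the way the corners are joined, so the quantity \<open>e\<close> below is the same modulo 4 for all
  states. This makes all exponents of the Jones polynomial congruent modulo 1.
\<close>

definition state_of_grade :: "tangle \<Rightarrow> int \<Rightarrow> int \<Rightarrow> (nat \<times> nat) set \<Rightarrow> bool" where
  "state_of_grade T e k G \<longleftrightarrow> G \<subseteq> edges T \<times> edges T \<and> 2 \<le> tangle_loops T G \<and>
     (joins_rows T G \<and> [k + 2 * int (tangle_loops T G) = e] (mod 4) \<or>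
      joins_columns T G \<and> [k + 2 * int (tangle_loops T G) + 2 = e] (mod 4))"

definition graded :: "tangle \<Rightarrow> int \<Rightarrow> bool" where
  "graded T e \<longleftrightarrow> {nw T, ne T, sw T, se T} \<union> labels (nodes T) = edges T \<and>
     (\<forall>(k, G)\<in>set (states (nodes T)). state_of_grade T e k G)"

lemma horizontal_twist_fields:
  fixes T
  defines "x \<equiv> 2 * length (nodes T) + 2"
  shows "nodes (horizontal_twist T) = Cross (Suc x) x (ne T) (se T) # nodes T"
    and "nw (horizontal_twist T) = nw T" and "ne (horizontal_twist T) = x"
    and "sw (horizontal_twist T) = sw T" and "se (horizontal_twist T) = Suc x"
    and "edges (horizontal_twist T) = insert (Suc x) (insert x (edges T))"
  by (auto simp: horizontal_twist_def Let_def x_def edges_def)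

lemma vertical_twist_fields:
  fixes T
  defines "x \<equiv> 2 * length (nodes T) + 2"
  shows "nodes (vertical_twist T) = Cross (Suc x) (se T) (sw T) x # nodes T"
    and "nw (vertical_twist T) = nw T" and "ne (vertical_twist T) = ne T"
    and "sw (vertical_twist T) = x" and "se (vertical_twist T) = Suc x"
    and "edges (vertical_twist T) = insert (Suc x) (insert x (edges T))"
  by (auto simp: vertical_twist_def Let_def x_def edges_def)

text \<open>The \<open>A\<close>-smoothing \<open>GA\<close> caps off the right ends of
  \<open>T\<close> and puts a vertical arc beside them; the \<open>B\<close>-smoothing
  \<open>GB\<close> prolongs the right ends.\<close>

lemma horizontal_twist_state:
  fixes G and T
  defines "x \<equiv> 2 * length (nodes T) + 2"
  defines "GA \<equiv> insert (Suc x, x) (insert (ne T, se T) G)"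
    and "GB \<equiv> insert (Suc x, se T) (insert (x, ne T) G)"
    and "T' \<equiv> horizontal_twist T"
  assumes G: "G \<subseteq> edges T \<times> edges T" and c: "{nw T, ne T, sw T, se T} \<subseteq> edges T"
  shows "joins_rows T' GB \<longleftrightarrow> joins_rows T G" and "joins_columns T' GB \<longleftrightarrow> joins_columns T G"
    and "tangle_loops T' GB = tangle_loops T G"
    and "joins_rows T G \<or> joins_columns T G \<Longrightarrow> joins_columns T' GA"
    and "tangle_loops T' GA =
      (if conn G (ne T) (se T) then Suc (tangle_loops T G) else tangle_loops T G)"
proof -
  have x: "x \<notin> edges T" "Suc x \<notin> edges T" "x \<noteq> Suc x"
    by (simp_all add: x_def edges_def)
  have cc: "nw T \<in> edges T" "ne T \<in> edges T" "sw T \<in> edges T" "se T \<in> edges T"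
    using c by blast+
  note fields = horizontal_twist_fields[of T, folded x_def T'_def]
  note B = conn_extend_strands[OF G cc(2) cc(4) x, folded GB_def]
  note A = conn_new_arc[OF G cc(2) cc(4) x, folded GA_def]
  show "joins_rows T' GB \<longleftrightarrow> joins_rows T G" "joins_columns T' GB \<longleftrightarrow> joins_columns T G"
    unfolding joins_rows_def joins_columns_def fields by (simp_all only: B cc)
  \<comment> \<open>If \<open>G\<close> joins rows, the left corners become connected through the
    arc from \<open>ne T\<close> to \<open>se T\<close>.\<close>
  show "joins_rows T G \<or> joins_columns T G \<Longrightarrow> joins_columns T' GA"
    unfolding joins_rows_def joins_columns_def fields
    by (simp only: A cc conn_insert) (use conn_sym in blast)
  show "tangle_loops T' GB = tangle_loops T G"
    unfolding fields GB_def using loops_extend_strands[OF G cc(2) cc(4) x] by simp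
  show "tangle_loops T' GA =
      (if conn G (ne T) (se T) then Suc (tangle_loops T G) else tangle_loops T G)"
    unfolding fields GA_def using loops_new_arc[OF G cc(2) cc(4) x] by simp
qed

text \<open>Below the tangle the smoothings change roles: \<open>GA\<close> prolongs the bottom ends
  and \<open>GB\<close> caps them off.\<close>

lemma vertical_twist_state:
  fixes G and T
  defines "x \<equiv> 2 * length (nodes T) + 2"
  defines "GA \<equiv> insert (Suc x, se T) (insert (sw T, x) G)"
    and "GB \<equiv> insert (Suc x, x) (insert (se T, sw T) G)"
    and "T' \<equiv> vertical_twist T"
  assumes G: "G \<subseteq> edges T \<times> edges T" and c: "{nw T, ne T, sw T, se T} \<subseteq> edges T"
  shows "joins_rows T' GA \<longleftrightarrow> joins_rows T G" and "joins_columns T' GA \<longleftrightarrow> joins_columns T G"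
    and "tangle_loops T' GA = tangle_loops T G"
    and "joins_rows T G \<or> joins_columns T G \<Longrightarrow> joins_rows T' GB"
    and "tangle_loops T' GB =
      (if conn G (sw T) (se T) then Suc (tangle_loops T G) else tangle_loops T G)"
proof -
  have x: "x \<notin> edges T" "Suc x \<notin> edges T" "x \<noteq> Suc x"
    by (simp_all add: x_def edges_def)
  have cc: "nw T \<in> edges T" "ne T \<in> edges T" "sw T \<in> edges T" "se T \<in> edges T"
    using c by blast+
  note fields = vertical_twist_fields[of T, folded x_def T'_def]
  \<comment> \<open>\<open>GA\<close> with one arc reversed to fit
    \<open>conn_extend_strands\<close>; connectivity ignores the order within a pair.\<close>
  define GA' where "GA' = insert (Suc x, se T) (insert (x, sw T) G)"
  have GA': "conn GA = conn GA'"
    unfolding GA_def GA'_def by (auto simp: fun_eq_iff conn_insert)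
  note A = conn_extend_strands[OF G cc(3) cc(4) x, folded GA'_def]
  note B = conn_new_arc[OF G cc(4) cc(3) x, folded GB_def]
  show "joins_rows T' GA \<longleftrightarrow> joins_rows T G" "joins_columns T' GA \<longleftrightarrow> joins_columns T G"
    unfolding joins_rows_def joins_columns_def fields GA' by (simp_all only: A cc)
  show "joins_rows T G \<or> joins_columns T G \<Longrightarrow> joins_rows T' GB"
    unfolding joins_rows_def joins_columns_def fields
    by (simp only: B cc conn_insert) (use conn_sym in blast)
  show "tangle_loops T' GA = tangle_loops T G"
    unfolding fields loops_conn GA'
    using loops_extend_strands[OF G cc(3) cc(4) x, folded GA'_def] by (simp add: loops_conn)
  show "tangle_loops T' GB =
      (if conn G (sw T) (se T) then Suc (tangle_loops T G) else tangle_loops T G)"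
    unfolding fields GB_def using loops_new_arc[OF G cc(4) cc(3) x]
    by (simp add: conn_commute[of G "se T"])
qed

lemma states_Cross:
  "set (states (Cross a b c d # D)) =
     (\<lambda>(k, G). (k + 1, insert (a, b) (insert (c, d) G))) ` set (states D) \<union>
     (\<lambda>(k, G). (k - 1, insert (a, d) (insert (b, c) G))) ` set (states D)"
  by auto

lemma graded_corners: "graded T e \<Longrightarrow> {nw T, ne T, sw T, se T} \<subseteq> edges T"
  by (auto simp: graded_def)

text \<open>The \<open>B\<close>-smoothing only lowers the exponent by 1. The
  \<open>A\<close>-smoothing raises it by 1 and either closes a loop or turns rows into columns,
  each worth 2, and \<open>3\<close> is \<open>-1\<close> modulo 4.\<close>

lemma graded_horizontal_twist:
  assumes "graded T e"
  shows "graded (horizontal_twist T) (e - 1)"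
proof -
  define x where "x = 2 * length (nodes T) + 2"
  let ?T' = "horizontal_twist T"
  note fields = horizontal_twist_fields[of T, folded x_def]
  have c: "{nw T, ne T, sw T, se T} \<subseteq> edges T"
    using assms by (rule graded_corners)
  have edges: "{nw ?T', ne ?T', sw ?T', se ?T'} \<union> labels (nodes ?T') = edges ?T'"
    using assms unfolding graded_def fields by (auto simp: labels_def)
  have "state_of_grade ?T' (e - 1) (k + 1) (insert (Suc x, x) (insert (ne T, se T) G))"
      (is "state_of_grade _ _ _ ?GA")
    and "state_of_grade ?T' (e - 1) (k - 1) (insert (Suc x, se T) (insert (x, ne T) G))"
      (is "state_of_grade _ _ _ ?GB")
    if "state_of_grade T e k G" for k G
  proof -
    have G: "G \<subseteq> edges T \<times> edges T" and two: "2 \<le> tangle_loops T G"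
      and alt: "joins_rows T G \<and> [k + 2 * int (tangle_loops T G) = e] (mod 4) \<or>
        joins_columns T G \<and> [k + 2 * int (tangle_loops T G) + 2 = e] (mod 4)"
      using that by (auto simp: state_of_grade_def)
    note st = horizontal_twist_state[OF G c, folded x_def]
    have "?GA \<subseteq> edges ?T' \<times> edges ?T'" "?GB \<subseteq> edges ?T' \<times> edges ?T'"
      using G c unfolding fields by auto
    moreover have "joins_rows T G \<Longrightarrow> \<not> conn G (ne T) (se T)"
      unfolding joins_rows_def by (meson conn_sym conn_trans)
    moreover have "joins_columns T G \<Longrightarrow> conn G (ne T) (se T)"
      by (simp add: joins_columns_def)
    moreover have "[k + 2 * c = e] (mod 4) \<Longrightarrow> [k + 1 + 2 * c + 2 = e - 1] (mod 4)"
      "[k + 2 * c + 2 = e] (mod 4) \<Longrightarrow> [k + 1 + 2 * (1 + c) + 2 = e - 1] (mod 4)"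
      "[k + 2 * c = e] (mod 4) \<Longrightarrow> [k - 1 + 2 * c = e - 1] (mod 4)"
      "[k + 2 * c + 2 = e] (mod 4) \<Longrightarrow> [k - 1 + 2 * c + 2 = e - 1] (mod 4)" for c
      unfolding cong_iff_dvd_diff by presburger+
    ultimately show "state_of_grade ?T' (e - 1) (k + 1) ?GA"
      and "state_of_grade ?T' (e - 1) (k - 1) ?GB"
      using two alt st unfolding state_of_grade_def by (auto simp only: if_True if_False of_nat_Suc)
  qed
  then show ?thesis
    using assms edges unfolding graded_def fields(1) states_Cross by fastforce
qed

text \<open>The \<open>A\<close>-smoothing only raises the exponent by 1. The
  \<open>B\<close>-smoothing lowers it by 1 and gains 2 modulo 4, by a new loop or by turning
  columns into rows.\<close>

lemma graded_vertical_twist: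
  assumes "graded T e"
  shows "graded (vertical_twist T) (e + 1)"
proof -
  define x where "x = 2 * length (nodes T) + 2"
  let ?T' = "vertical_twist T"
  note fields = vertical_twist_fields[of T, folded x_def]
  have c: "{nw T, ne T, sw T, se T} \<subseteq> edges T"
    using assms by (rule graded_corners)
  have edges: "{nw ?T', ne ?T', sw ?T', se ?T'} \<union> labels (nodes ?T') = edges ?T'"
    using assms unfolding graded_def fields by (auto simp: labels_def)
  have "state_of_grade ?T' (e + 1) (k + 1) (insert (Suc x, se T) (insert (sw T, x) G))"
      (is "state_of_grade _ _ _ ?GA")
    and "state_of_grade ?T' (e + 1) (k - 1) (insert (Suc x, x) (insert (se T, sw T) G))"
      (is "state_of_grade _ _ _ ?GB")
    if "state_of_grade T e k G" for k G
  proof -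
    have G: "G \<subseteq> edges T \<times> edges T" and two: "2 \<le> tangle_loops T G"
      and alt: "joins_rows T G \<and> [k + 2 * int (tangle_loops T G) = e] (mod 4) \<or>
        joins_columns T G \<and> [k + 2 * int (tangle_loops T G) + 2 = e] (mod 4)"
      using that by (auto simp: state_of_grade_def)
    note st = vertical_twist_state[OF G c, folded x_def]
    have "?GA \<subseteq> edges ?T' \<times> edges ?T'" "?GB \<subseteq> edges ?T' \<times> edges ?T'"
      using G c unfolding fields by auto
    moreover have "joins_columns T G \<Longrightarrow> \<not> conn G (sw T) (se T)"
      unfolding joins_columns_def by (meson conn_sym conn_trans)
    moreover have "joins_rows T G \<Longrightarrow> conn G (sw T) (se T)"
      by (simp add: joins_rows_def)
    moreover have "[k + 2 * c + 2 = e] (mod 4) \<Longrightarrow> [k - 1 + 2 * c = e + 1] (mod 4)"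
      "[k + 2 * c = e] (mod 4) \<Longrightarrow> [k - 1 + 2 * (1 + c) = e + 1] (mod 4)"
      "[k + 2 * c = e] (mod 4) \<Longrightarrow> [k + 1 + 2 * c = e + 1] (mod 4)"
      "[k + 2 * c + 2 = e] (mod 4) \<Longrightarrow> [k + 1 + 2 * c + 2 = e + 1] (mod 4)" for c
      unfolding cong_iff_dvd_diff by presburger+
    ultimately show "state_of_grade ?T' (e + 1) (k + 1) ?GA"
      and "state_of_grade ?T' (e + 1) (k - 1) ?GB"
      using two alt st unfolding state_of_grade_def by (auto simp only: if_True if_False of_nat_Suc)
  qed
  then show ?thesis
    using assms edges unfolding graded_def fields(1) states_Cross by fastforce
qed

lemma conn_empty [simp]: "conn {} u v \<longleftrightarrow> u = v"
  by (simp add: conn_def)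

lemma loops_no_arcs: "loops L {} = card L"
  unfolding loops_conn by (rule card_image) (auto simp only: inj_on_def conn_class_eq_iff conn_empty)

lemma graded_zero_tangle: "graded zero_tangle 0"
  by (auto simp: graded_def zero_tangle_def labels_def state_of_grade_def joins_rows_def
      edges_def loops_no_arcs cong_def)

lemma graded_infinity_tangle: "graded infinity_tangle 2"
  by (auto simp: graded_def infinity_tangle_def labels_def state_of_grade_def joins_columns_def
      edges_def loops_no_arcs cong_def)

section \<open>Row and column coefficients of a tangle\<close>

definition loop_weight :: "complex \<Rightarrow> complex" where
  "loop_weight A = - (A\<^sup>2) - A powi (- 2)"

text \<open>
  The bracket of a tangle is \<open>a\<langle>0\<rangle> + b\<langle>\<infinity>\<rangle>\<close> with \<open>a\<close> the row and \<open>b\<close> the column coefficient.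
  The exponent \<open>tangle_loops T G - 2\<close> leaves out the two components that contain the corners.
\<close>

definition row_coeff :: "complex \<Rightarrow> tangle \<Rightarrow> complex" where
  "row_coeff A T = (\<Sum>(k, G)\<leftarrow>states (nodes T).
     if joins_rows T G then A powi k * loop_weight A ^ (tangle_loops T G - 2) else 0)"

definition column_coeff :: "complex \<Rightarrow> tangle \<Rightarrow> complex" where
  "column_coeff A T = (\<Sum>(k, G)\<leftarrow>states (nodes T).
     if joins_columns T G then A powi k * loop_weight A ^ (tangle_loops T G - 2) else 0)"

lemma sum_list_states_Cross:
  fixes f :: "int \<Rightarrow> (nat \<times> nat) set \<Rightarrow> 'a :: comm_monoid_add"
  shows "(\<Sum>(k, G)\<leftarrow>states (Cross a b c d # D). f k G) =
    (\<Sum>(k, G)\<leftarrow>states D. f (k + 1) (insert (a, b) (insert (c, d) G)) +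
       f (k - 1) (insert (a, d) (insert (b, c) G)))"
  by (simp add: o_def case_prod_unfold sum_list_addf)

text \<open>Twisting the tangle 0 gives one crossing, which resolves into \<open>A\<close> times
  \<infinity> plus \<open>inverse A\<close> times 0. Twisting the tangle \<infinity> only adds a
  curl, which contributes the factor \<open>- (A ^ 3)\<close>.\<close>

lemma coeff_horizontal_twist:
  assumes "graded T e" and A: "A \<noteq> 0"
  shows "row_coeff A (horizontal_twist T) = inverse A * row_coeff A T"
    and "column_coeff A (horizontal_twist T) = A * row_coeff A T - A ^ 3 * column_coeff A T"
proof -
  define x where "x = 2 * length (nodes T) + 2"
  let ?T' = "horizontal_twist T"
  let ?GA = "\<lambda>G. insert (Suc x, x) (insert (ne T, se T) G)"
  let ?GB = "\<lambda>G. insert (Suc x, se T) (insert (x, ne T) G)"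
  let ?w = "\<lambda>T k G. A powi k * loop_weight A ^ (tangle_loops T G - 2)"
  note fields = horizontal_twist_fields[of T, folded x_def]
  have c: "{nw T, ne T, sw T, se T} \<subseteq> edges T"
    using assms(1) by (rule graded_corners)
  have step: "(if joins_rows ?T' (?GA G) then ?w ?T' (k + 1) (?GA G) else 0) +
        (if joins_rows ?T' (?GB G) then ?w ?T' (k - 1) (?GB G) else 0) =
      inverse A * (if joins_rows T G then ?w T k G else 0)"
    "(if joins_columns ?T' (?GA G) then ?w ?T' (k + 1) (?GA G) else 0) +
        (if joins_columns ?T' (?GB G) then ?w ?T' (k - 1) (?GB G) else 0) =
      A * (if joins_rows T G then ?w T k G else 0) -
      A ^ 3 * (if joins_columns T G then ?w T k G else 0)"
    if "(k, G) \<in> set (states (nodes T))" for k G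
  proof -
    have "state_of_grade T e k G"
      using assms(1) that by (auto simp: graded_def)
    then have G: "G \<subseteq> edges T \<times> edges T" and two: "2 \<le> tangle_loops T G"
      and alt: "joins_rows T G \<or> joins_columns T G"
      by (auto simp: state_of_grade_def)
    note st = horizontal_twist_state[OF G c, folded x_def]
    have GA: "joins_columns ?T' (?GA G)" "\<not> joins_rows ?T' (?GA G)"
      using st(4) alt not_joins_both by blast+
    have pw: "A powi (k - 1) = inverse A * A powi k" "A powi (k + 1) = A * A powi k"
      using A by (simp_all add: power_int_diff power_int_add field_simps)
    show "(if joins_rows ?T' (?GA G) then ?w ?T' (k + 1) (?GA G) else 0) +
        (if joins_rows ?T' (?GB G) then ?w ?T' (k - 1) (?GB G) else 0) =
      inverse A * (if joins_rows T G then ?w T k G else 0)"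
      using GA st(1,3) pw by simp
    show "(if joins_columns ?T' (?GA G) then ?w ?T' (k + 1) (?GA G) else 0) +
        (if joins_columns ?T' (?GB G) then ?w ?T' (k - 1) (?GB G) else 0) =
      A * (if joins_rows T G then ?w T k G else 0) -
      A ^ 3 * (if joins_columns T G then ?w T k G else 0)"
    proof (cases "joins_rows T G")
      case True
      then have "\<not> conn G (ne T) (se T)" "\<not> joins_columns T G"
        unfolding joins_rows_def joins_columns_def by (meson conn_sym conn_trans)+
      then show ?thesis
        using True GA st(2,5) pw by simp
    next
      case False
      then have J: "joins_columns T G" "conn G (ne T) (se T)"
        using alt by (auto simp: joins_columns_def)
      have "Suc (tangle_loops T G) - 2 = Suc (tangle_loops T G - 2)"
        using two by simp
      moreover have "A * A powi k * (loop_weight A * w) + inverse A * A powi k * w =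
          - (A ^ 3 * (A powi k * w))" for w
      proof -
        \<comment> \<open>The effect of a Reidemeister I move on the bracket.\<close>
        have "A * loop_weight A + inverse A = - (A ^ 3)"
          using A by (simp add: loop_weight_def power_int_minus field_simps power2_eq_square power3_eq_cube)
        moreover have "A * A powi k * (loop_weight A * w) + inverse A * A powi k * w =
            (A * loop_weight A + inverse A) * (A powi k * w)"
          by (simp add: algebra_simps)
        ultimately show ?thesis
          by simp
      qed
      ultimately show ?thesis
        using False J GA st(2,3,5) pw by simp
    qed
  qed
  show "row_coeff A (horizontal_twist T) = inverse A * row_coeff A T"
    unfolding row_coeff_def fields(1) sum_list_states_Cross sum_list_const_mult[symmetric]
    by (rule arg_cong[of _ _ sum_list], rule map_cong[OF refl]) (use step(1) in force)
  show "column_coeff A (horizontal_twist T) = A * row_coeff A T - A ^ 3 * column_coeff A T"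
    unfolding row_coeff_def column_coeff_def fields(1) sum_list_states_Cross
      sum_list_const_mult[symmetric] sum_list_subtractf[symmetric]
    by (rule arg_cong[of _ _ sum_list], rule map_cong[OF refl]) (use step(2) in force)
qed

text \<open>The horizontal case with rows and columns, and \<open>A\<close> and
  \<open>inverse A\<close>, exchanged; the curl now sits on the tangle 0 and has the opposite
  sense.\<close>

lemma coeff_vertical_twist:
  assumes "graded T e" and A: "A \<noteq> 0"
  shows "column_coeff A (vertical_twist T) = A * column_coeff A T"
    and "row_coeff A (vertical_twist T) =
      inverse A * column_coeff A T - inverse A ^ 3 * row_coeff A T"
proof -
  define x where "x = 2 * length (nodes T) + 2"
  let ?T' = "vertical_twist T"
  let ?GA = "\<lambda>G. insert (Suc x, se T) (insert (sw T, x) G)"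
  let ?GB = "\<lambda>G. insert (Suc x, x) (insert (se T, sw T) G)"
  let ?w = "\<lambda>T k G. A powi k * loop_weight A ^ (tangle_loops T G - 2)"
  note fields = vertical_twist_fields[of T, folded x_def]
  have c: "{nw T, ne T, sw T, se T} \<subseteq> edges T"
    using assms(1) by (rule graded_corners)
  have step: "(if joins_columns ?T' (?GA G) then ?w ?T' (k + 1) (?GA G) else 0) +
        (if joins_columns ?T' (?GB G) then ?w ?T' (k - 1) (?GB G) else 0) =
      A * (if joins_columns T G then ?w T k G else 0)"
    "(if joins_rows ?T' (?GA G) then ?w ?T' (k + 1) (?GA G) else 0) +
        (if joins_rows ?T' (?GB G) then ?w ?T' (k - 1) (?GB G) else 0) =
      inverse A * (if joins_columns T G then ?w T k G else 0) -
      inverse A ^ 3 * (if joins_rows T G then ?w T k G else 0)"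
    if "(k, G) \<in> set (states (nodes T))" for k G
  proof -
    have "state_of_grade T e k G"
      using assms(1) that by (auto simp: graded_def)
    then have G: "G \<subseteq> edges T \<times> edges T" and two: "2 \<le> tangle_loops T G"
      and alt: "joins_rows T G \<or> joins_columns T G"
      by (auto simp: state_of_grade_def)
    note st = vertical_twist_state[OF G c, folded x_def]
    have GB: "joins_rows ?T' (?GB G)" "\<not> joins_columns ?T' (?GB G)"
      using st(4) alt not_joins_both by blast+
    have pw: "A powi (k - 1) = inverse A * A powi k" "A powi (k + 1) = A * A powi k"
      using A by (simp_all add: power_int_diff power_int_add field_simps)
    show "(if joins_columns ?T' (?GA G) then ?w ?T' (k + 1) (?GA G) else 0) +
        (if joins_columns ?T' (?GB G) then ?w ?T' (k - 1) (?GB G) else 0) =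
      A * (if joins_columns T G then ?w T k G else 0)"
      using GB st(2,3) pw by simp
    show "(if joins_rows ?T' (?GA G) then ?w ?T' (k + 1) (?GA G) else 0) +
        (if joins_rows ?T' (?GB G) then ?w ?T' (k - 1) (?GB G) else 0) =
      inverse A * (if joins_columns T G then ?w T k G else 0) -
      inverse A ^ 3 * (if joins_rows T G then ?w T k G else 0)"
    proof (cases "joins_columns T G")
      case True
      then have "\<not> conn G (sw T) (se T)" "\<not> joins_rows T G"
        unfolding joins_rows_def joins_columns_def by (meson conn_sym conn_trans)+
      then show ?thesis
        using True GB st(1,5) pw by simp
    next
      case False
      then have J: "joins_rows T G" "conn G (sw T) (se T)"
        using alt by (auto simp: joins_rows_def)
      have "Suc (tangle_loops T G) - 2 = Suc (tangle_loops T G - 2)"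
        using two by simp
      moreover have "A * A powi k * w + inverse A * A powi k * (loop_weight A * w) =
          - (inverse A ^ 3 * (A powi k * w))" for w
      proof -
        have "A + inverse A * loop_weight A = - (inverse A ^ 3)"
          using A by (simp add: loop_weight_def power_int_minus field_simps power2_eq_square power3_eq_cube)
        moreover have "A * A powi k * w + inverse A * A powi k * (loop_weight A * w) =
            (A + inverse A * loop_weight A) * (A powi k * w)"
          by (simp add: algebra_simps)
        ultimately show ?thesis
          by simp
      qed
      ultimately show ?thesis
        using False J GB st(1,3,5) pw by simp
    qed
  qed
  show "column_coeff A (vertical_twist T) = A * column_coeff A T"
    unfolding column_coeff_def fields(1) sum_list_states_Cross sum_list_const_mult[symmetric]
    by (rule arg_cong[of _ _ sum_list], rule map_cong[OF refl]) (use step(1) in force)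
  show "row_coeff A (vertical_twist T) =
      inverse A * column_coeff A T - inverse A ^ 3 * row_coeff A T"
    unfolding row_coeff_def column_coeff_def fields(1) sum_list_states_Cross
      sum_list_const_mult[symmetric] sum_list_subtractf[symmetric]
    by (rule arg_cong[of _ _ sum_list], rule map_cong[OF refl]) (use step(2) in force)
qed

section \<open>Numerator closure\<close>

lemma labels_numerator_closure:
  assumes "graded T e"
  shows "labels (numerator_closure T) = edges T"
  using assms by (auto simp: graded_def labels_def numerator_closure_def)

text \<open>For rows, each closing arc joins the two ends of one strand. For columns, one arc merges
  the two strands and the other then closes the result.\<close>

lemma loops_numerator_closure:
  assumes G: "G \<subseteq> edges T \<times> edges T" and c: "{nw T, ne T, sw T, se T} \<subseteq> edges T"
  defines "G' \<equiv> insert (nw T, ne T) (insert (sw T, se T) G)"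
  shows "joins_rows T G \<Longrightarrow> tangle_loops T G' = tangle_loops T G"
    and "joins_columns T G \<Longrightarrow> Suc (tangle_loops T G') = tangle_loops T G"
proof -
  assume "joins_rows T G"
  then have "conn G (sw T) (se T)" "conn (insert (sw T, se T) G) (nw T) (ne T)"
    by (auto simp: joins_rows_def conn_insert)
  then show "tangle_loops T G' = tangle_loops T G"
    by (simp add: G'_def loops_insert_connected)
next
  assume J: "joins_columns T G"
  then have 1: "\<not> conn G (sw T) (se T)"
    unfolding joins_columns_def by (meson conn_sym conn_trans)
  have 2: "conn (insert (sw T, se T) G) (nw T) (ne T)"
    using J conn_sym by (auto simp: joins_columns_def conn_insert)
  show "Suc (tangle_loops T G') = tangle_loops T G"
    unfolding G'_def loops_insert_connected[OF 2]
    by (rule loops_insert_unconnected[OF 1]) (use c in auto)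
qed

lemma bracket_numerator_closure:
  assumes "graded T e"
  shows "bracket (numerator_closure T) = (\<Sum>(k, G)\<leftarrow>states (nodes T).
    Poly_Mapping.single k 1 * loop_value ^
      (tangle_loops T (insert (nw T, ne T) (insert (sw T, se T) G)) - 1))"
  unfolding bracket_def labels_numerator_closure[OF assms]
  by (simp add: numerator_closure_def o_def case_prod_unfold)

text \<open>This explains the extra 2 for columns in \<open>state_of_grade\<close>: there the
  closure has one loop less than for rows, which lowers the exponent by 2 modulo 4.\<close>

lemma homogeneous_bracket_closure:
  assumes "graded T e"
  shows "homogeneous_mod4 (e - 2) (bracket (numerator_closure T))"
  unfolding bracket_numerator_closure[OF assms]
proof (rule homogeneous_mod4_sum_list, clarify)
  fix k G assume "(k, G) \<in> set (states (nodes T))"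
  then have "state_of_grade T e k G"
    using assms by (auto simp: graded_def)
  then have G: "G \<subseteq> edges T \<times> edges T" and two: "2 \<le> tangle_loops T G"
    and alt: "joins_rows T G \<and> [k + 2 * int (tangle_loops T G) = e] (mod 4) \<or>
      joins_columns T G \<and> [k + 2 * int (tangle_loops T G) + 2 = e] (mod 4)"
    by (auto simp: state_of_grade_def)
  define c' where "c' = tangle_loops T (insert (nw T, ne T) (insert (sw T, se T) G))"
  have c': "joins_rows T G \<Longrightarrow> c' = tangle_loops T G"
    "joins_columns T G \<Longrightarrow> Suc c' = tangle_loops T G"
    unfolding c'_def by (rule loops_numerator_closure[OF G graded_corners[OF assms]]; simp)+
  have eq: "[k + int (c' - 1) * 2 = e - 2] (mod 4)"
    using alt
  proof (elim disjE conjE)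
    assume "joins_rows T G" "[k + 2 * int (tangle_loops T G) = e] (mod 4)"
    then show ?thesis
      using c'(1) two unfolding cong_iff_dvd_diff by (simp add: of_nat_diff algebra_simps)
  next
    assume J: "joins_columns T G" and "[k + 2 * int (tangle_loops T G) + 2 = e] (mod 4)"
    then have "4 dvd k + 2 * int (Suc c') + 2 - e"
      using c'(2) unfolding cong_iff_dvd_diff by simp
    moreover have "int (c' - 1) = int c' - 1"
      using c'(2)[OF J] two by simp
    ultimately show ?thesis
      unfolding cong_iff_dvd_diff by simp presburger
  qed
  have "homogeneous_mod4 (k + int (c' - 1) * 2) (Poly_Mapping.single k 1 * loop_value ^ (c' - 1))"
    by (intro homogeneous_mod4_mult homogeneous_mod4_power homogeneous_mod4_loop_value
        homogeneous_mod4_single cong_refl)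
  then show "homogeneous_mod4 (e - 2) (Poly_Mapping.single k 1 * loop_value ^
      (tangle_loops T (insert (nw T, ne T) (insert (sw T, se T) G)) - 1))"
    using eq unfolding homogeneous_mod4_def c'_def by (meson cong_trans)
qed

text \<open>The tangle 0 closes up to two circles, with bracket \<open>loop_weight A\<close>, and
  \<infinity> to one circle, with bracket 1.\<close>

lemma laurent_eval_bracket_closure:
  assumes "graded T e" and A: "A \<noteq> 0"
  shows "laurent_eval A (bracket (numerator_closure T)) =
    loop_weight A * row_coeff A T + column_coeff A T"
proof -
  have lv: "laurent_eval A loop_value = loop_weight A"
    by (simp add: loop_value_def loop_weight_def laurent_eval_diff laurent_eval_uminus)
  let ?w = "\<lambda>k G. A powi k * loop_weight A ^ (tangle_loops T G - 2)"
  have step: "A powi k * loop_weight A ^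
        (tangle_loops T (insert (nw T, ne T) (insert (sw T, se T) G)) - 1) =
      loop_weight A * (if joins_rows T G then ?w k G else 0) +
      (if joins_columns T G then ?w k G else 0)"
    if "(k, G) \<in> set (states (nodes T))" for k G
  proof -
    have "state_of_grade T e k G"
      using assms(1) that by (auto simp: graded_def)
    then have G: "G \<subseteq> edges T \<times> edges T" and two: "2 \<le> tangle_loops T G"
      and alt: "joins_rows T G \<or> joins_columns T G"
      by (auto simp: state_of_grade_def)
    note closure = loops_numerator_closure[OF G graded_corners[OF assms(1)]]
    show ?thesis
    proof (cases "joins_rows T G")
      case True
      moreover have "tangle_loops T G - 1 = Suc (tangle_loops T G - 2)"
        using two by simp
      ultimately show ?thesis
        using closure(1) not_joins_both by simp
    next
      case False
      then have "tangle_loops T (insert (nw T, ne T) (insert (sw T, se T) G)) - 1 =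
          tangle_loops T G - 2"
        using closure(2) alt by (metis Suc_1 diff_Suc_Suc One_nat_def)
      then show ?thesis
        using False alt by simp
    qed
  qed
  have "laurent_eval A (bracket (numerator_closure T)) =
      (\<Sum>(k, G)\<leftarrow>states (nodes T). A powi k * loop_weight A ^
        (tangle_loops T (insert (nw T, ne T) (insert (sw T, se T) G)) - 1))"
    unfolding bracket_numerator_closure[OF assms(1)] laurent_eval_sum_list
    by (simp add: case_prod_unfold laurent_eval_mult[OF A] laurent_eval_power[OF A] lv)
  also have "\<dots> = loop_weight A * row_coeff A T + column_coeff A T"
    unfolding row_coeff_def column_coeff_def
      sum_list_const_mult[symmetric] sum_list_addf[symmetric]
    by (rule arg_cong[of _ _ sum_list], rule map_cong[OF refl]) (use step in force)
  finally show ?thesis .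
qed

text \<open>Every crossing contributes 1 or -1 both to the exponent of the state and to the
  writhe.\<close>

lemma even_state_writhe:
  assumes "length ds = length D" and "(k, G) \<in> set (states D)"
  shows "even (k + writhe D ds)"
  using assms
proof (induction D arbitrary: ds k G)
  case Nil
  then show ?case
    by (simp add: writhe_def)
next
  case (Cons x D)
  then obtain u v ds' where ds: "ds = (u, v) # ds'" "length ds' = length D"
    by (cases ds) auto
  then have w: "writhe (x # D) ds = node_sign x (u, v) + writhe D ds'"
    by (simp add: writhe_def)
  show ?case
    using Cons.prems(2) Cons.IH[OF ds(2)] unfolding w by (cases x) (fastforce split: if_splits)+
qed

text \<open>Supplies the state from which the parity of the grade is read off.\<close>

lemma states_nonempty: "states D \<noteq> []"
  by (induction D rule: states.induct) auto

lemma even_grade_writhe: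
  assumes "graded T e" and "length ds = length (numerator_closure T)"
  shows "even (e + writhe (numerator_closure T) ds)"
proof -
  obtain k G where kG: "(k, G) \<in> set (states (nodes T))"
    using states_nonempty[of "nodes T"] by (metis list.set_intros(1) neq_Nil_conv surj_pair)
  then have "state_of_grade T e k G"
    using assms(1) by (auto simp: graded_def)
  then have "4 dvd k + 2 * int (tangle_loops T G) - e \<or> 4 dvd k + 2 * int (tangle_loops T G) + 2 - e"
    unfolding state_of_grade_def cong_iff_dvd_diff by blast
  then have "even (k - e)"
    by presburger
  moreover have "(k, {(nw T, ne T)} \<union> ({(sw T, se T)} \<union> G)) \<in> set (states (numerator_closure T))"
    using kG by (force simp: numerator_closure_def)
  then have "even (k + writhe (numerator_closure T) ds)"
    using assms(2) even_state_writhe by blast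
  ultimately show ?thesis
    by presburger
qed

section \<open>Fractions modulo 4\<close>

text \<open>
  When \<open>A\<^sup>8 = - 1\<close>, twisting four times multiplies the pair of coefficients by a phase, so up to a
  phase \<open>u\<close> it depends only on the fraction \<open>p / q\<close> of the tangle modulo 4. The rules are named
  after the six points \<open>p / q\<close> of the projective line over the integers modulo 4.
\<close>

inductive bracket_class :: "complex \<Rightarrow> nat \<Rightarrow> nat \<Rightarrow> complex \<Rightarrow> complex \<Rightarrow> bool" for A where
  zero: "cmod u = 1 \<Longrightarrow> p mod 4 = 0 \<Longrightarrow> odd q \<Longrightarrow> bracket_class A p q u 0"
| one: "cmod u = 1 \<Longrightarrow> odd p \<Longrightarrow> p mod 4 = q mod 4 \<Longrightarrow> bracket_class A p q u (u * A ^ 2)"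
| two: "cmod u = 1 \<Longrightarrow> p mod 4 = 2 \<Longrightarrow> odd q \<Longrightarrow> bracket_class A p q u (u * (A ^ 2 - A ^ 6))"
| three: "cmod u = 1 \<Longrightarrow> odd p \<Longrightarrow> (p + q) mod 4 = 0 \<Longrightarrow> bracket_class A p q u (- u * A ^ 6)"
| infinity: "cmod u = 1 \<Longrightarrow> odd p \<Longrightarrow> q mod 4 = 0 \<Longrightarrow> bracket_class A p q 0 u"
| half: "cmod u = 1 \<Longrightarrow> odd p \<Longrightarrow> q mod 4 = 2 \<Longrightarrow> bracket_class A p q (u * (A ^ 2 - A ^ 6)) u"

text \<open>Removes inverses, so that the identities in the case analyses below become polynomial
  consequences of \<open>A ^ 8 = - 1\<close>, which \<open>algebra\<close> can check.\<close>

lemma inverse_root: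
  fixes A :: complex
  assumes "A ^ 8 = - 1"
  shows "inverse A = - (A ^ 7)"
  using assms by (intro inverse_unique) (simp add: power_Suc[symmetric] del: power_Suc)

text \<open>Adding 1 to the fraction permutes 0, 1, 2, 3 cyclically and fixes \<infinity> and 1/2.
  On the cycle the new phase is the new row coefficient; at the two fixed points it is the new
  column coefficient.\<close>

lemma bracket_class_horizontal:
  assumes A: "A ^ 8 = - 1" and "bracket_class A p q a b"
  shows "bracket_class A (p + q) q (inverse A * a) (A * a - A ^ 3 * b)"
proof -
  note phase = norm_mult norm_power cmod_root[OF A]
  show ?thesis
    using assms(2)
  proof cases
    case zero
    have eq1: "inverse A * a = - (A ^ 7) * a"
      unfolding zero inverse_root[OF A] by simp
    have eq2: "A * a - A ^ 3 * b = - (A ^ 7) * a * A ^ 2"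
      unfolding zero inverse_root[OF A] using A by algebra
    show ?thesis
      unfolding eq1 eq2
      by (rule bracket_class.one) (use zero in \<open>simp add: phase\<close>, (use zero in presburger)+)
  next
    case one
    have eq1: "inverse A * a = - (A ^ 7) * a"
      unfolding one inverse_root[OF A] by simp
    have eq2: "A * a - A ^ 3 * b = - (A ^ 7) * a * (A ^ 2 - A ^ 6)"
      unfolding one inverse_root[OF A] using A by algebra
    show ?thesis
      unfolding eq1 eq2
      by (rule bracket_class.two) (use one in \<open>simp add: phase\<close>, (use one in presburger)+)
  next
    case two
    have eq1: "inverse A * a = - (A ^ 7) * a"
      unfolding two inverse_root[OF A] by simp
    have eq2: "A * a - A ^ 3 * b = - (- (A ^ 7) * a) * A ^ 6"
      unfolding two inverse_root[OF A] using A by algebra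
    show ?thesis
      unfolding eq1 eq2
      by (rule bracket_class.three) (use two in \<open>simp add: phase\<close>, (use two in presburger)+)
  next
    case three
    have eq1: "inverse A * a = - (A ^ 7) * a"
      unfolding three inverse_root[OF A] by simp
    have eq2: "A * a - A ^ 3 * b = 0"
      unfolding three inverse_root[OF A] using A by algebra
    show ?thesis
      unfolding eq1 eq2
      by (rule bracket_class.zero) (use three in \<open>simp add: phase\<close>, (use three in presburger)+)
  next
    case infinity
    have eq1: "inverse A * a = 0"
      unfolding infinity inverse_root[OF A] by simp
    have eq2: "A * a - A ^ 3 * b = - (A ^ 3) * b"
      unfolding infinity inverse_root[OF A] by simp
    show ?thesis
      unfolding eq1 eq2
      by (rule bracket_class.infinity) (use infinity in \<open>simp add: phase\<close>, (use infinity in presburger)+)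
  next
    case half
    have eq1: "inverse A * a = - (A ^ 7) * b * (A ^ 2 - A ^ 6)"
      unfolding half inverse_root[OF A] by algebra
    have eq2: "A * a - A ^ 3 * b = - (A ^ 7) * b"
      unfolding half inverse_root[OF A] by algebra
    show ?thesis
      unfolding eq1 eq2
      by (rule bracket_class.half) (use half in \<open>simp add: phase\<close>, (use half in presburger)+)
  qed
qed

text \<open>Adding 1 to the reciprocal permutes \<infinity>, 1, 1/2, 3 cyclically and fixes 0 and
  2.\<close>

lemma bracket_class_vertical:
  assumes A: "A ^ 8 = - 1" and "bracket_class A p q a b"
  shows "bracket_class A p (p + q) (inverse A * b - inverse A ^ 3 * a) (A * b)"
proof -
  note phase = norm_mult norm_power cmod_root[OF A]
  show ?thesis
    using assms(2)
  proof cases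
    case zero
    have eq1: "inverse A * b - inverse A ^ 3 * a = A ^ 5 * a"
      unfolding zero inverse_root[OF A] using A by algebra
    have eq2: "A * b = 0"
      unfolding zero inverse_root[OF A] by simp
    show ?thesis
      unfolding eq1 eq2
      by (rule bracket_class.zero) (use zero in \<open>simp add: phase\<close>, (use zero in presburger)+)
  next
    case one
    have eq1: "inverse A * b - inverse A ^ 3 * a = A ^ 3 * a * (A ^ 2 - A ^ 6)"
      unfolding one inverse_root[OF A] using A by algebra
    have eq2: "A * b = A ^ 3 * a"
      unfolding one inverse_root[OF A] by algebra
    show ?thesis
      unfolding eq1 eq2
      by (rule bracket_class.half) (use one in \<open>simp add: phase\<close>, (use one in presburger)+)
  next
    case two
    have eq1: "inverse A * b - inverse A ^ 3 * a = A * a"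
      unfolding two inverse_root[OF A] using A by algebra
    have eq2: "A * b = A * a * (A ^ 2 - A ^ 6)"
      unfolding two inverse_root[OF A] by algebra
    show ?thesis
      unfolding eq1 eq2
      by (rule bracket_class.two) (use two in \<open>simp add: phase\<close>, (use two in presburger)+)
  next
    case three
    have eq1: "inverse A * b - inverse A ^ 3 * a = 0"
      unfolding three inverse_root[OF A] using A by algebra
    have eq2: "A * b = - (A ^ 7) * a"
      unfolding three inverse_root[OF A] by algebra
    show ?thesis
      unfolding eq1 eq2
      by (rule bracket_class.infinity) (use three in \<open>simp add: phase\<close>, (use three in presburger)+)
  next
    case infinity
    have eq1: "inverse A * b - inverse A ^ 3 * a = - (A ^ 7) * b"
      unfolding infinity inverse_root[OF A] by simp
    have eq2: "A * b = - (A ^ 7) * b * A ^ 2"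
      unfolding infinity inverse_root[OF A] using A by algebra
    show ?thesis
      unfolding eq1 eq2
      by (rule bracket_class.one) (use infinity in \<open>simp add: phase\<close>, (use infinity in presburger)+)
  next
    case half
    have eq1: "inverse A * b - inverse A ^ 3 * a = A ^ 3 * b"
      unfolding half inverse_root[OF A] using A by algebra
    have eq2: "A * b = - (A ^ 3 * b) * A ^ 6"
      unfolding half inverse_root[OF A] using A by algebra
    show ?thesis
      unfolding eq1 eq2
      by (rule bracket_class.three) (use half in \<open>simp add: phase\<close>, (use half in presburger)+)
  qed
qed

section \<open>Classes of rational tangles\<close>

definition tangle_of_class :: "complex \<Rightarrow> nat \<Rightarrow> nat \<Rightarrow> tangle \<Rightarrow> bool" where
  "tangle_of_class A p q T \<longleftrightarrow>
     (\<exists>e. graded T e) \<and> bracket_class A p q (row_coeff A T) (column_coeff A T)"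

lemma tangle_of_class_horizontal:
  assumes A: "A ^ 8 = - 1" and "tangle_of_class A p q T"
  shows "tangle_of_class A (p + q) q (horizontal_twist T)"
proof -
  obtain e where e: "graded T e"
    using assms(2) by (auto simp: tangle_of_class_def)
  have "A \<noteq> 0"
    using A by auto
  then show ?thesis
    using assms(2) bracket_class_horizontal[OF A] graded_horizontal_twist[OF e]
    by (auto simp: tangle_of_class_def coeff_horizontal_twist[OF e])
qed

lemma tangle_of_class_vertical:
  assumes A: "A ^ 8 = - 1" and "tangle_of_class A p q T"
  shows "tangle_of_class A p (p + q) (vertical_twist T)"
proof -
  obtain e where e: "graded T e"
    using assms(2) by (auto simp: tangle_of_class_def)
  have "A \<noteq> 0"
    using A by auto
  then show ?thesis
    using assms(2) bracket_class_vertical[OF A] graded_vertical_twist[OF e]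
    by (auto simp: tangle_of_class_def coeff_vertical_twist[OF e])
qed

lemma tangle_of_class_zero: "tangle_of_class A 0 1 zero_tangle"
proof -
  have "row_coeff A zero_tangle = 1" "column_coeff A zero_tangle = 0"
    by (simp_all add: row_coeff_def column_coeff_def zero_tangle_def joins_rows_def
        joins_columns_def edges_def loops_no_arcs)
  then show ?thesis
    using graded_zero_tangle bracket_class.zero[of 1 0 1 A] by (auto simp: tangle_of_class_def)
qed

lemma tangle_of_class_infinity: "tangle_of_class A 1 0 infinity_tangle"
proof -
  have "row_coeff A infinity_tangle = 0" "column_coeff A infinity_tangle = 1"
    by (simp_all add: row_coeff_def column_coeff_def infinity_tangle_def joins_rows_def
        joins_columns_def edges_def loops_no_arcs)
  then show ?thesis
    using graded_infinity_tangle bracket_class.infinity[of 1 1 0 A] by (auto simp: tangle_of_class_def)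
qed

text \<open>Each division step of the Euclidean algorithm is a block of \<open>r div s\<close>
  twists. Both kinds of tangle are treated at once because the kind alternates from one block to the
  next.\<close>

lemma tangle_of_class_rational_tangle:
  assumes A: "A ^ 8 = - 1" and "coprime r s"
  shows "tangle_of_class A r s (rational_tangle True (cfrac r s)) \<and>
    tangle_of_class A s r (rational_tangle False (cfrac r s))"
  using assms(2)
proof (induction r s rule: cfrac.induct)
  case (1 r s)
  show ?case
  proof (cases "s = 0")
    case True
    then show ?thesis
      \<comment> \<open>With \<open>s = 0\<close>, coprimality forces \<open>r = 1\<close>, the
        class of the initial tangles.\<close>
      using "1.prems" tangle_of_class_zero tangle_of_class_infinity by (simp add: cfrac.simps[of _ 0])
  next
    case False
    have "coprime s (r mod s)"
      using "1.prems" False by (simp add: coprime_commute)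
    then have IH: "tangle_of_class A s (r mod s) (rational_tangle True (cfrac s (r mod s)))"
      "tangle_of_class A (r mod s) s (rational_tangle False (cfrac s (r mod s)))"
      using "1.IH"[OF False] by auto
    have h: "tangle_of_class A (p + n * q) q ((horizontal_twist ^^ n) T)"
      if "tangle_of_class A p q T" for p q n T
    proof (induction n)
      case (Suc n)
      show ?case
        using tangle_of_class_horizontal[OF A Suc] by (simp add: algebra_simps)
    qed (use that in simp)
    have v: "tangle_of_class A q (p + n * q) ((vertical_twist ^^ n) T)"
      if "tangle_of_class A q p T" for p q n T
    proof (induction n)
      case (Suc n)
      show ?case
        using tangle_of_class_vertical[OF A Suc] by (simp add: algebra_simps)
    qed (use that in simp)
    show ?thesis
      using h[OF IH(2), of "r div s"] v[OF IH(1), of "r div s"] False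
      by (simp add: cfrac.simps[of r s])
  qed
qed

text \<open>Here \<open>loop_weight A\<close> is \<open>A ^ 6 - A ^ 2\<close>. Only the points 0 and
  2 have even numerator: at 0 this weight survives as \<open>A ^ 2 * (- 1 - \<i>)\<close>, at 2 it
  cancels. At the other four points a number of modulus 1 remains.\<close>

lemma bracket_class_closure_norm:
  assumes A: "A ^ 4 = - \<i>" and "bracket_class A p q a b"
  shows "(cmod (loop_weight A * a + b))\<^sup>2 = (if odd p then 1 else if p mod 4 = 0 then 2 else 0)"
proof -
  have A8: "A ^ 8 = - 1"
    using arg_cong[OF A, of "\<lambda>x. x ^ 2"] by (simp flip: power_mult)
  have "A powi (- 2) = (inverse A)\<^sup>2"
    by (simp add: power_int_minus power_inverse)
  also have "\<dots> = - (A ^ 6)"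
    unfolding inverse_root[OF A8] using A8 by algebra
  finally have lw: "loop_weight A = A ^ 6 - A ^ 2"
    by (simp add: loop_weight_def)
  note nA = cmod_root[OF A8]
  show ?thesis
    using assms(2)
  proof cases
    case zero
    have eq: "loop_weight A * a + b = a * A ^ 2 * (- 1 - \<i>)"
      unfolding zero lw using A by algebra
    have "even p"
      using zero by presburger
    then show ?thesis
      unfolding eq using zero nA by (simp add: norm_mult norm_power power_mult_distrib cmod_power2)
  next
    case one
    have "loop_weight A * a + b = a * A ^ 6"
      unfolding one lw by algebra
    then show ?thesis
      using one nA by (simp add: norm_mult norm_power)
  next
    case two
    have "loop_weight A * a + b = 0"
      unfolding two lw by algebra
    then show ?thesis
      using two by (simp, presburger)
  next
    case three
    have "loop_weight A * a + b = - (a * A ^ 2)"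
      unfolding three lw by algebra
    then show ?thesis
      using three nA by (simp add: norm_mult norm_power)
  next
    case infinity
    then show ?thesis
      by simp
  next
    case half
    \<comment> \<open>From \<open>A ^ 8 = - 1\<close> follows
      \<open>(A ^ 2 - A ^ 6) ^ 2 = 2\<close>, so the first summand is
      \<open>- 2 * b\<close>.\<close>
    have eq: "loop_weight A * a + b = - b"
      unfolding half lw using A8 by algebra
    show ?thesis
      unfolding eq using half by simp
  qed
qed

theorem theorem8p3:
  fixes r s :: int and \<alpha> :: rat and ds :: "direction list"
  assumes "coprime r s" and "s > 0" and "\<alpha> = of_int r / of_int s" and "\<alpha> > 1"
    and "is_orientation (rational_link \<alpha>) ds"
  shows "([r = 2] (mod 4) \<longrightarrow> normalized_jones (rational_link \<alpha>) ds \<i> = 0) \<and>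
         ([r = 0] (mod 4) \<longrightarrow>
            normalized_jones (rational_link \<alpha>) ds \<i> \<in> {1 + \<i>, - (1 + \<i>), 1 - \<i>, - (1 - \<i>)}) \<and>
         ([r = 1] (mod 4) \<or> [r = 3] (mod 4) \<longrightarrow>
            normalized_jones (rational_link \<alpha>) ds \<i> \<in> {1, - 1, \<i>, - \<i>})"
proof -
  \<comment> \<open>Chosen so that \<open>t = A powi (- 4)\<close> equals \<open>\<i>\<close>, which
    is \<open>- inverse q\<close> at \<open>q = \<i>\<close>.\<close>
  define A where "A = cis (- (pi / 8))"
  have A: "A ^ 4 = - \<i>"
    by (simp add: A_def DeMoivre complex_eq_iff del: cis_inverse)
  have A8: "A ^ 8 = - 1"
    using arg_cong[OF A, of "\<lambda>x. x ^ 2"] by (simp flip: power_mult)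
  have A0: "A \<noteq> 0"
    by (simp add: A_def)
  define T where "T = rational_tangle True (cfrac (nat r) (nat s))"
  have "quotient_of \<alpha> = (r, s)"
    using assms(1-3) by (simp add: Fract_of_int_quotient[symmetric] quotient_of_Fract normalize_stable)
  then have link: "rational_link \<alpha> = numerator_closure T"
    by (simp add: rational_link_def T_def)
  have "of_int s < (of_int r :: rat)"
    using assms(2-4) by (simp add: less_divide_eq)
  then have r: "r > 0"
    using assms(2) by linarith
  then have "coprime (nat r) (nat s)"
    using assms(1,2) coprime_int_iff[of "nat r" "nat s"] by simp
  then have cl: "tangle_of_class A (nat r) (nat s) T"
    using tangle_of_class_rational_tangle[OF A8] by (simp add: T_def)
  then obtain e where e: "graded T e"
    by (auto simp: tangle_of_class_def)
  define z where "z = normalized_jones (rational_link \<alpha>) ds \<i>"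
  have "length ds = length (numerator_closure T)"
    using assms(5) by (simp add: is_orientation_def link)
  then have "even (e - 2 + writhe (numerator_closure T) ds)"
    using even_grade_writhe[OF e] by simp
  then have "cmod z = cmod (laurent_eval A (bracket (numerator_closure T)))"
    unfolding z_def link by (rule cmod_normalized_jones[OF A homogeneous_bracket_closure[OF e]])
  moreover have "bracket_class A (nat r) (nat s) (row_coeff A T) (column_coeff A T)"
    using cl by (simp add: tangle_of_class_def)
  ultimately have "(cmod z)\<^sup>2 = (if odd (nat r) then 1 else if nat r mod 4 = 0 then 2 else 0)"
    unfolding laurent_eval_bracket_closure[OF e A0]
    using bracket_class_closure_norm[OF A] by metis
  moreover have "odd (nat r) \<longleftrightarrow> odd r" "nat r mod 4 = 0 \<longleftrightarrow> r mod 4 = 0"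
  proof -
    obtain n where "r = int n"
      using r by (metis zero_less_imp_eq_int)
    then show "odd (nat r) \<longleftrightarrow> odd r" "nat r mod 4 = 0 \<longleftrightarrow> r mod 4 = 0"
      by simp_all presburger
  qed
  ultimately have norm: "(cmod z)\<^sup>2 = (if odd r then 1 else if r mod 4 = 0 then 2 else 0)"
    by simp
  have gz: "gaussian z"
    by (simp add: z_def gaussian_normalized_jones)
  have "z = 0" if "[r = 2] (mod 4)"
  proof -
    have "r mod 4 = 2"
      using that by (simp add: cong_def)
    moreover from this have "even r"
      by presburger
    ultimately show ?thesis
      using norm by simp
  qed
  moreover have "z \<in> {1 + \<i>, - (1 + \<i>), 1 - \<i>, - (1 - \<i>)}" if "[r = 0] (mod 4)"
  proof -
    have "r mod 4 = 0"
      using that by (simp add: cong_def)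
    moreover from this have "even r"
      by presburger
    ultimately show ?thesis
      using norm gaussian_norm_eq_2[OF gz] by simp
  qed
  moreover have "z \<in> {1, - 1, \<i>, - \<i>}" if "[r = 1] (mod 4) \<or> [r = 3] (mod 4)"
  proof -
    have "r mod 4 = 1 \<or> r mod 4 = 3"
      using that by (simp add: cong_def)
    then have "odd r"
      by presburger
    then show ?thesis
      using norm gaussian_norm_eq_1[OF gz] by simp
  qed
  ultimately show ?thesis
    unfolding z_def by blast
qed

end
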